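(* Let $d\ge2$. For any $\nu\in(0,1]$ and $\epsilon\in(0,1)$ there exists $\delta_1>0$ depending only on $d,\epsilon,\nu$ such that if a domain $\Omega\subset\mathbb R^d$ satisfies $\langle\mathrm{TER}\rangle_{\delta_1}$, then there is a measurable function $\phi:\Omega\to\mathbb R$ such that: (1) for every $(\alpha^{ij})\in\mathrm M(\nu^2,1)$, $\sum_{i,j}\alpha^{ij}D_{ij}\phi\le0$ in the sense of distributions on $\Omega$; (2) there exists $N=N(d,\nu,\epsilon,R_{0,\delta_1}/R_{\infty,\delta_1})>0$ with $N^{-1}\rho(x)^{1-\epsilon}\le\phi(x)\le N\rho(x)^{1-\epsilon}$ for all $x\in\Omega$.
   Context: $\rho(x)=\mathrm{dist}(x,\partial\Omega)$. $\mathrm M(\nu_1,\nu_2)$: real symmetric $d\times d$ matrices with $\nu_1|\xi|^2\le\sum\alpha^{ij}\xi_i\xi_j\le\nu_2|\xi|^2$. $\mathbf{ER}_\Omega$ is the set of $(\delta,R)\in[0,1]\times(0,\infty)$ such that for each $p\in\partial\Omega$ and each connected component $\Omega^{(i)}_{p,R}$ of $\Omega\cap B(p,R)$ there is a unit vector $e^{(i)}_{p,R}$ with $\Omega^{(i)}_{p,R}\subset\{x\in B_R(p):(x-p)\cdot e^{(i)}_{p,R}<\delta R\}$; $\delta_\Omega(R)$ is the infimum of $\delta$ with $(\delta,R)\in\mathbf{ER}_\Omega$. For $\delta\in[0,1]$, $\Omega$ satisfies $\langle\mathrm{TER}\rangle_\delta$ if there exist $0<R_{0,\delta}\le R_{\infty,\delta}<\infty$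 with $\delta_\Omega(R)\le\delta$ whenever $R\le R_{0,\delta}$ or $R\ge R_{\infty,\delta}$. *)

theory Defs
  imports "HOL-Analysis.Analysis"
begin

definition bdist :: "(real^'n) set \<Rightarrow> real^'n \<Rightarrow> real" where
  "bdist \<Omega> x = infdist x (frontier \<Omega>)"

definition domain :: "(real^'n) set \<Rightarrow> bool" where
  "domain \<Omega> \<longleftrightarrow> open \<Omega> \<and> connected \<Omega> \<and> \<Omega> \<noteq> {}"

definition ER :: "(real^'n) set \<Rightarrow> (real \<times> real) set" where
  "ER \<Omega> = {(\<delta>, R). 0 \<le> \<delta> \<and> \<delta> \<le> 1 \<and> 0 < R \<and>
     (\<forall>p\<in>frontier \<Omega>. \<forall>C\<in>components (\<Omega> \<inter> ball p R).
        \<exists>e. norm e = 1 \<and> C \<subseteq> {x\<in>ball p R. (x - p) \<bullet> e < \<delta> * R})}"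

definition delta_Omega :: "(real^'n) set \<Rightarrow> real \<Rightarrow> real" where
  "delta_Omega \<Omega> R = Inf {\<delta>. (\<delta>, R) \<in> ER \<Omega>}"

definition TER_radii :: "(real^'n) set \<Rightarrow> real \<Rightarrow> real \<Rightarrow> real \<Rightarrow> bool" where
  "TER_radii \<Omega> \<delta> R0 Rinf \<longleftrightarrow> 0 < R0 \<and> R0 \<le> Rinf \<and>
     (\<forall>R>0. (R \<le> R0 \<or> R \<ge> Rinf) \<longrightarrow> delta_Omega \<Omega> R \<le> \<delta>)"

definition TER :: "(real^'n) set \<Rightarrow> real \<Rightarrow> bool" where
  "TER \<Omega> \<delta> \<longleftrightarrow> (\<exists>R0 Rinf. TER_radii \<Omega> \<delta> R0 Rinf)"

definition pd :: "'n::finite \<Rightarrow> (real^'n \<Rightarrow> real) \<Rightarrow> real^'n \<Rightarrow> real" where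
  "pd i f x = deriv (\<lambda>t. f (x + t *\<^sub>R axis i 1)) 0"

fun iter_pd :: "'n::finite list \<Rightarrow> (real^'n \<Rightarrow> real) \<Rightarrow> real^'n \<Rightarrow> real" where
  "iter_pd [] f = f"
| "iter_pd (i # is) f = pd i (iter_pd is f)"

definition smooth_fun :: "(real^'n::finite \<Rightarrow> real) \<Rightarrow> bool" where
  "smooth_fun f \<longleftrightarrow> (\<forall>is. continuous_on UNIV (iter_pd is f) \<and>
     (\<forall>i x. (\<lambda>t. iter_pd is f (x + t *\<^sub>R axis i 1)) differentiable (at 0)))"

definition test_fun :: "(real^'n::finite) set \<Rightarrow> (real^'n \<Rightarrow> real) \<Rightarrow> bool" where
  "test_fun \<Omega> \<psi> \<longleftrightarrow> smooth_fun \<psi> \<and> compact (closure {x. \<psi> x \<noteq> 0}) \<and>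
     closure {x. \<psi> x \<noteq> 0} \<subseteq> \<Omega>"

definition Mat :: "real \<Rightarrow> real \<Rightarrow> (real^'n^'n) set" where
  "Mat \<nu>1 \<nu>2 = {a. transpose a = a \<and>
     (\<forall>\<xi>. \<nu>1 * norm \<xi> ^ 2 \<le> \<xi> \<bullet> (a *v \<xi>) \<and> \<xi> \<bullet> (a *v \<xi>) \<le> \<nu>2 * norm \<xi> ^ 2)}"

definition Lop :: "real^'n::finite^'n \<Rightarrow> (real^'n \<Rightarrow> real) \<Rightarrow> real^'n \<Rightarrow> real" where
  "Lop a \<psi> x = (\<Sum>i\<in>UNIV. \<Sum>j\<in>UNIV. a $ i $ j * pd i (pd j \<psi>) x)"

definition distrib_supersol :: "real^'n::finite^'n \<Rightarrow> (real^'n) set \<Rightarrow> (real^'n \<Rightarrow> real) \<Rightarrow> bool" where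
  "distrib_supersol a \<Omega> \<phi> \<longleftrightarrow> (\<forall>\<psi>. test_fun \<Omega> \<psi> \<and> (\<forall>x. \<psi> x \<ge> 0) \<longrightarrow>
      set_integrable lborel \<Omega> (\<lambda>x. \<phi> x * Lop a \<psi> x) \<and>
      (LINT x:\<Omega>|lborel. \<phi> x * Lop a \<psi> x) \<le> 0)"

end

theory Submission
  imports Defs
begin

text \<open>
  Near a boundary point \<open>p\<close>, at scale \<open>R\<close>, a component of the domain lies in an almost half ball
  \<open>{s < \<delta>}\<close>, where \<open>y = (x - p) / R\<close> and \<open>s = y \<bullet> e\<close>. With \<open>D = d / \<nu>\<^sup>2\<close> the quadratic polynomial
  \<open>q = D (2 \<delta> - s - s\<^sup>2) + |y|\<^sup>2\<close> is a supersolution for every admissible matrix, because its Hessian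
  is \<open>2 (I - D e \<otimes> e) / R\<^sup>2\<close>. It is bounded below by a positive constant, it is at least \<open>1/4\<close> where
  \<open>|y| \<ge> 1/2\<close>, and it is at most \<open>3 D / M\<close> where \<open>|y| \<le> 1 / M\<close>, if \<open>\<delta> = 1 / (2 M)\<close>. Let \<open>\<phi>\<close> be the
  infimum of \<open>R\<^sup>\<alpha> q\<close> with \<open>\<alpha> = 1 - \<epsilon>\<close> over all boundary points, all controlled scales and all
  valid directions. If \<open>M\<^sup>\<epsilon> \<ge> 12 D\<close>, then a polynomial at scale \<open>R\<close> is beaten by one at a scale at least
  \<open>M R\<close> as soon as \<open>|x - p| \<ge> R / 2\<close>. Hence near \<open>x\<close> only polynomials that are valid on the whole ball
  of radius \<open>\<rho> x\<close> about \<open>x\<close> matter, and \<open>\<phi>\<close> inherits from them that its second differences along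
  directions \<open>u\<^sub>k\<close> with \<open>a = \<Sum>\<^sub>k u\<^sub>k \<otimes> u\<^sub>k\<close> have nonpositive sum. Moving these differences onto
  the test function and letting the step tend to zero gives the inequality in the sense of distributions.
\<close>

section \<open>Rank-one decomposition\<close>

text \<open>Cholesky elimination: subtracting one rank-one term clears row and column
  \<open>k\<close> and leaves a positive semidefinite remainder. The set \<open>S\<close> records
  which rows may still be nonzero, so the induction never changes the index type.\<close>

lemma psd_rank_one_sum:
  fixes A :: "'n::finite \<Rightarrow> 'n \<Rightarrow> real"
  assumes "finite S" and "\<And>i j. A i j = A j i"
    and "\<And>i j. i \<notin> S \<Longrightarrow> A i j = 0"
    and "\<And>\<xi>. 0 \<le> (\<Sum>i\<in>UNIV. \<Sum>j\<in>UNIV. \<xi> i * \<xi> j * A i j)"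
  shows "\<exists>u::'n \<Rightarrow> 'n \<Rightarrow> real. \<forall>i j. A i j = (\<Sum>k\<in>S. u k i * u k j)"
  using assms
proof (induction S arbitrary: A rule: finite_induct)
  case empty
  then show ?case by auto
next
  case (insert k S)
  have expand: "(\<Sum>i\<in>UNIV. \<Sum>j\<in>UNIV. (\<xi> i + (if i = k then t else 0)) * (\<xi> j + (if j = k then t else 0)) * A i j)
      = (\<Sum>i\<in>UNIV. \<Sum>j\<in>UNIV. \<xi> i * \<xi> j * A i j) + 2 * t * (\<Sum>i\<in>UNIV. \<xi> i * A i k) + t\<^sup>2 * A k k"
    for \<xi> t
  proof -
    have "(\<Sum>i\<in>UNIV. \<Sum>j\<in>UNIV. (\<xi> i + (if i = k then t else 0)) * (\<xi> j + (if j = k then t else 0)) * A i j)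
      = (\<Sum>i\<in>UNIV. \<Sum>j\<in>UNIV. \<xi> i * \<xi> j * A i j + (if i = k then t * \<xi> j * A k j else 0)
           + (if j = k then t * \<xi> i * A i k else 0) + (if i = k then if j = k then t\<^sup>2 * A k k else 0 else 0))"
      by (intro sum.cong refl) (auto simp: algebra_simps power2_eq_square)
    also have "\<dots> = (\<Sum>i\<in>UNIV. \<Sum>j\<in>UNIV. \<xi> i * \<xi> j * A i j) + (\<Sum>j\<in>UNIV. t * \<xi> j * A k j)
        + (\<Sum>i\<in>UNIV. t * \<xi> i * A i k) + t\<^sup>2 * A k k"
    proof -
      have "(\<Sum>i\<in>UNIV. \<Sum>j\<in>UNIV. if i = k then t * \<xi> j * A k j else 0) = (\<Sum>j\<in>UNIV. t * \<xi> j * A k j)"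
        by (subst sum.swap) simp
      moreover have "(\<Sum>i\<in>UNIV. \<Sum>j\<in>UNIV. if i = k then if j = k then t\<^sup>2 * A k k else 0 else 0) = t\<^sup>2 * A k k"
      proof -
        have "(\<Sum>j\<in>UNIV. if i = k then if j = k then t\<^sup>2 * A k k else 0 else 0) = (if i = k then t\<^sup>2 * A k k else 0)" for i
          by simp
        then show ?thesis by simp
      qed
      ultimately show ?thesis by (simp add: sum.distrib)
    qed
    also have "(\<Sum>j\<in>UNIV. t * \<xi> j * A k j) = t * (\<Sum>i\<in>UNIV. \<xi> i * A i k)"
      by (simp add: sum_distrib_left mult.assoc insert.prems(1)[of k])
    also have "(\<Sum>i\<in>UNIV. t * \<xi> i * A i k) = t * (\<Sum>i\<in>UNIV. \<xi> i * A i k)"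
      by (simp add: sum_distrib_left mult.assoc)
    finally show ?thesis by simp
  qed
  have nonneg: "0 \<le> (\<Sum>i\<in>UNIV. \<Sum>j\<in>UNIV. \<xi> i * \<xi> j * A i j) + 2 * t * (\<Sum>i\<in>UNIV. \<xi> i * A i k) + t\<^sup>2 * A k k"
    for \<xi> t
    using insert.prems(3)[of "\<lambda>i. \<xi> i + (if i = k then t else 0)"] unfolding expand .
  have akk: "0 \<le> A k k" using nonneg[of "\<lambda>_. 0" 1] by simp
  \<comment> \<open>With a zero diagonal entry the form is affine in \<open>t\<close>; at the chosen
    \<open>t\<close> it would equal -1.\<close>
  have row: "A k k = 0 \<Longrightarrow> A i k = 0" for i
  proof (rule ccontr)
    assume z: "A k k = 0" and nz: "A i k \<noteq> 0"
    let ?\<xi> = "\<lambda>j. if j = i then 1 else (0::real)"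
    have s1: "(\<Sum>j\<in>UNIV. ?\<xi> j * A j k) = A i k"
      by (simp add: if_distrib[of "\<lambda>x. x * _"] cong: if_cong)
    have s2: "(\<Sum>i'\<in>UNIV. \<Sum>j\<in>UNIV. ?\<xi> i' * ?\<xi> j * A i' j) = A i i"
      by (simp add: if_distrib[of "\<lambda>x. x * _"] if_distrib[of "\<lambda>x. _ * x"] cong: if_cong)
    have "0 \<le> A i i + 2 * (- (A i i + 1) / (2 * A i k)) * A i k"
      using nonneg[of ?\<xi> "- (A i i + 1) / (2 * A i k)"] unfolding s1 s2 z by simp
    then show False using nz by (simp add: field_simps)
  qed
  \<comment> \<open>If \<open>A k k = 0\<close>, division by zero gives \<open>w = 0\<close>, which
    is right because \<open>row\<close> makes the whole row vanish.\<close>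
  define w where "w i = A i k / sqrt (A k k)" for i
  \<comment> \<open>The Schur complement: its quadratic form is that of \<open>A\<close> minimised over the \<open>k\<close>-th coordinate.\<close>
  define A' where "A' i j = A i j - w i * w j" for i j
  have ww: "w i * w j = A i k * A j k / A k k" for i j
    using akk by (simp add: w_def)
  have sym: "A' i j = A' j i" for i j
    unfolding A'_def using insert.prems(1)[of i j] by simp
  have supp: "A' i j = 0" if "i \<notin> S" for i j
  proof (cases "i = k")
    case True
    then show ?thesis
      using row[of j] insert.prems(1)[of k j] unfolding A'_def ww by (cases "A k k = 0") auto
  next
    case False
    then have "A i l = 0" for l using that insert.prems(2)[of i l] by auto
    then show ?thesis unfolding A'_def ww by simp
  qed
  have psd: "0 \<le> (\<Sum>i\<in>UNIV. \<Sum>j\<in>UNIV. \<xi> i * \<xi> j * A' i j)" for \<xi>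
  proof -
    define s where "s = (\<Sum>i\<in>UNIV. \<xi> i * A i k)"
    have "(\<Sum>i\<in>UNIV. \<Sum>j\<in>UNIV. \<xi> i * \<xi> j * A' i j)
       = (\<Sum>i\<in>UNIV. \<Sum>j\<in>UNIV. \<xi> i * \<xi> j * A i j) - (\<Sum>i\<in>UNIV. \<Sum>j\<in>UNIV. (\<xi> i * A i k) * (\<xi> j * A j k) / A k k)"
      unfolding sum_subtractf[symmetric] A'_def ww by (intro sum.cong refl) (simp add: algebra_simps)
    also have "(\<Sum>i\<in>UNIV. \<Sum>j\<in>UNIV. (\<xi> i * A i k) * (\<xi> j * A j k) / A k k) = s * s / A k k"
      unfolding s_def by (simp add: sum_product sum_divide_distrib)
    finally have eq: "(\<Sum>i\<in>UNIV. \<Sum>j\<in>UNIV. \<xi> i * \<xi> j * A' i j)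
       = (\<Sum>i\<in>UNIV. \<Sum>j\<in>UNIV. \<xi> i * \<xi> j * A i j) - s * s / A k k" .
    \<comment> \<open>\<open>- s / A k k\<close> is the minimising shift of the \<open>k\<close>-th
      coordinate; for \<open>A k k = 0\<close> both sides are 0.\<close>
    have "2 * (- s / A k k) * s + (- s / A k k)\<^sup>2 * A k k = - (s * s / A k k)"
      by (cases "A k k = 0") (simp_all add: power2_eq_square field_simps)
    then show ?thesis using nonneg[of \<xi> "- s / A k k"] unfolding eq s_def[symmetric] by simp
  qed
  obtain u where u: "\<And>i j. A' i j = (\<Sum>l\<in>S. u l i * u l j)"
    using insert.IH[of A'] sym supp psd by blast
  have "A i j = (\<Sum>l\<in>insert k S. (u(k := w)) l i * (u(k := w)) l j)" for i j
  proof -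
    have "(\<Sum>l\<in>S. (u(k := w)) l i * (u(k := w)) l j) = (\<Sum>l\<in>S. u l i * u l j)"
      using insert.hyps(2) by (intro sum.cong) auto
    then show ?thesis
      using insert.hyps u[of i j] by (simp add: A'_def)
  qed
  then show ?case by blast
qed

section \<open>Second differences of test functions\<close>

lemma pd_DERIV:
  fixes f :: "real^'n::finite \<Rightarrow> real"
  assumes "\<And>i x. (\<lambda>t. f (x + t *\<^sub>R axis i 1)) differentiable (at 0)"
  shows "((\<lambda>t. f (x + t *\<^sub>R axis i 1)) has_real_derivative pd i f (x + t *\<^sub>R axis i 1)) (at t)"
proof -
  have "((\<lambda>s. f ((x + t *\<^sub>R axis i 1) + s *\<^sub>R axis i 1)) has_real_derivative pd i f (x + t *\<^sub>R axis i 1)) (at 0)"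
    unfolding pd_def DERIV_deriv_iff_real_differentiable by (rule assms)
  then have "((\<lambda>s. f (x + (s + t) *\<^sub>R axis i 1)) has_real_derivative pd i f (x + t *\<^sub>R axis i 1)) (at 0)"
    by (simp add: algebra_simps)
  then show ?thesis
    using DERIV_shift[of "\<lambda>s. f (x + s *\<^sub>R axis i 1)" _ 0 t] by simp
qed

text \<open>Moves one coordinate at a time and applies the mean value theorem to each move. The
  intermediate points vary with the coordinate but stay within \<open>norm v\<close> of
  \<open>x\<close>, which is all that continuity of the partials needs.\<close>

lemma increment_partials:
  fixes f :: "real^'n::finite \<Rightarrow> real"
  assumes diff: "\<And>i x. (\<lambda>t. f (x + t *\<^sub>R axis i 1)) differentiable (at 0)"
    and "finite S" and "\<And>i. i \<notin> S \<Longrightarrow> v $ i = 0"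
  shows "\<exists>\<xi>. (\<forall>i. norm (\<xi> i) \<le> norm v) \<and> f (x + v) - f x = (\<Sum>i\<in>S. v $ i * pd i f (x + \<xi> i))"
  using assms(2,3)
proof (induction S arbitrary: v rule: finite_induct)
  case empty
  then have "v = 0" by (simp add: vec_eq_iff)
  then show ?case by (intro exI[of _ "\<lambda>_. 0"]) auto
next
  case (insert k S)
  define w where "w = (\<chi> i. if i = k then 0 else v $ i)"
  have v: "v = w + (v $ k) *\<^sub>R axis k 1"
    by (simp add: vec_eq_iff w_def axis_def)
  have "w $ i = 0" if "i \<notin> S" for i using insert.prems[of i] that by (auto simp: w_def)
  then obtain \<xi> where \<xi>: "\<And>i. norm (\<xi> i) \<le> norm w"
    "f (x + w) - f x = (\<Sum>i\<in>S. w $ i * pd i f (x + \<xi> i))"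
    using insert.IH[of w] by blast
  have wv: "norm w \<le> norm v"
    by (rule norm_le_componentwise_cart) (simp add: w_def)
  have S: "(\<Sum>i\<in>S. w $ i * pd i f (x + \<xi> i)) = (\<Sum>i\<in>S. v $ i * pd i f (x + \<xi> i))"
    using insert.hyps by (intro sum.cong refl) (auto simp: w_def)
  have "\<exists>t. \<bar>t\<bar> \<le> \<bar>v $ k\<bar> \<and>
      f (x + w + (v $ k) *\<^sub>R axis k 1) - f (x + w) = v $ k * pd k f (x + w + t *\<^sub>R axis k 1)"
  proof -
    let ?g = "\<lambda>t. f (x + w + t *\<^sub>R axis k 1)" and ?g' = "\<lambda>t. pd k f (x + w + t *\<^sub>R axis k 1)"
    note D = pd_DERIV[OF diff, of "x + w" k]
    consider "v $ k = 0" | "v $ k > 0" | "v $ k < 0" by linarith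
    then show ?thesis
    proof cases
      case 1
      then show ?thesis by auto
    next
      case 2
      then obtain t where "0 < t" "t < v $ k" "?g (v $ k) - ?g 0 = (v $ k - 0) * ?g' t"
        using MVT2[of 0 "v $ k" ?g ?g'] D by auto
      then show ?thesis by (intro exI[of _ t]) auto
    next
      case 3
      then obtain t where "v $ k < t" "t < 0" "?g 0 - ?g (v $ k) = (0 - v $ k) * ?g' t"
        using MVT2[of "v $ k" 0 ?g ?g'] D by auto
      then show ?thesis by (intro exI[of _ t]) auto
    qed
  qed
  then obtain t where t: "\<bar>t\<bar> \<le> \<bar>v $ k\<bar>"
      "f (x + v) - f (x + w) = v $ k * pd k f (x + (w + t *\<^sub>R axis k 1))"
    by (metis add.assoc v)
  have "norm (w + t *\<^sub>R axis k 1) \<le> norm v"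
    using t(1) by (intro norm_le_componentwise_cart) (auto simp: w_def axis_def)
  moreover have "norm (\<xi> i) \<le> norm v" for i using \<xi>(1)[of i] wv by linarith
  moreover have "f (x + v) - f x = (\<Sum>i\<in>insert k S. v $ i * pd i f (x + (\<xi>(k := w + t *\<^sub>R axis k 1)) i))"
  proof -
    have "(\<Sum>i\<in>S. v $ i * pd i f (x + (\<xi>(k := w + t *\<^sub>R axis k 1)) i)) = (\<Sum>i\<in>S. v $ i * pd i f (x + \<xi> i))"
      using insert.hyps by (intro sum.cong refl) auto
    then show ?thesis using t(2) \<xi>(2) S insert.hyps by simp
  qed
  ultimately show ?case
    by (intro exI[of _ "\<xi>(k := w + t *\<^sub>R axis k 1)"]) auto
qed

text \<open>\<open>smooth_fun\<close> speaks of derivatives along the axes only; the total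
  derivative gives access to the arbitrary directions \<open>u k\<close> of a rank-one
  decomposition.\<close>

lemma has_derivative_continuous_partials:
  fixes f :: "real^'n::finite \<Rightarrow> real"
  assumes diff: "\<And>i x. (\<lambda>t. f (x + t *\<^sub>R axis i 1)) differentiable (at 0)"
    and cont: "\<And>i. continuous_on UNIV (pd i f)"
  shows "(f has_derivative (\<lambda>v. \<Sum>i\<in>UNIV. v $ i * pd i f x)) (at x)"
  unfolding has_derivative_at_alt
proof (intro conjI allI impI)
  show "bounded_linear (\<lambda>v. \<Sum>i\<in>UNIV. v $ i * pd i f x)"
    by (intro bounded_linear_sum bounded_linear_mult_const bounded_linear_vec_nth)
next
  fix e :: real assume e: "0 < e"
  \<comment> \<open>The error \<open>e\<close> is shared equally among the coordinates.\<close>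
  define e' where "e' = e / CARD('n)"
  have e': "e' > 0" using e by (simp add: e'_def)
  have "\<forall>i. \<exists>d>0. \<forall>y. dist y x < d \<longrightarrow> dist (pd i f y) (pd i f x) < e'"
    using cont e' unfolding continuous_on_iff by (metis UNIV_I)
  then obtain d where d: "\<And>i. d i > 0" "\<And>i y. dist y x < d i \<Longrightarrow> dist (pd i f y) (pd i f x) < e'"
    by metis
  define d0 where "d0 = Min (range d)"
  have d0: "d0 > 0" "\<And>i. d0 \<le> d i" using d(1) by (auto simp: d0_def)
  have "norm (f y - f x - (\<Sum>i\<in>UNIV. (y - x) $ i * pd i f x)) \<le> e * norm (y - x)"
    if y: "norm (y - x) < d0" for y
  proof -
    obtain \<xi> where \<xi>: "\<And>i. norm (\<xi> i) \<le> norm (y - x)"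
      "f (x + (y - x)) - f x = (\<Sum>i\<in>UNIV. (y - x) $ i * pd i f (x + \<xi> i))"
      using increment_partials[OF diff, of UNIV "y - x" x] by auto
    have b: "\<bar>pd i f (x + \<xi> i) - pd i f x\<bar> \<le> e'" for i
      using d(2)[of "x + \<xi> i" i] \<xi>(1)[of i] d0(2)[of i] y by (auto simp: dist_norm)
    have "f y - f x - (\<Sum>i\<in>UNIV. (y - x) $ i * pd i f x)
        = (\<Sum>i\<in>UNIV. (y - x) $ i * (pd i f (x + \<xi> i) - pd i f x))"
      using \<xi>(2) by (simp add: right_diff_distrib sum_subtractf)
    also have "\<bar>\<dots>\<bar> \<le> (\<Sum>i\<in>UNIV. \<bar>(y - x) $ i * (pd i f (x + \<xi> i) - pd i f x)\<bar>)"
      by (rule sum_abs)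
    also have "\<dots> \<le> (\<Sum>i\<in>(UNIV::'n set). norm (y - x) * e')"
      using b component_le_norm_cart[of "y - x"]
      by (intro sum_mono) (auto simp: abs_mult intro!: mult_mono simp del: vector_minus_component)
    also have "\<dots> = e * norm (y - x)" by (simp add: e'_def)
    finally show ?thesis by simp
  qed
  then show "\<exists>d>0. \<forall>y. norm (y - x) < d \<longrightarrow> norm (f y - f x - (\<Sum>i\<in>UNIV. (y - x) $ i * pd i f x)) \<le> e * norm (y - x)"
    using d0(1) by blast
qed

lemma smooth_fun_pd: "smooth_fun f \<Longrightarrow> smooth_fun (pd i f)"
proof -
  assume f: "smooth_fun f"
  have "iter_pd is (pd i f) = iter_pd (is @ [i]) f" for "is"
    by (induction "is") auto
  then show ?thesis using f unfolding smooth_fun_def by simp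
qed

lemma smooth_fun_continuous: "smooth_fun f \<Longrightarrow> continuous_on UNIV f"
  unfolding smooth_fun_def by (metis iter_pd.simps(1))

lemma smooth_fun_DERIV_line:
  fixes f :: "real^'n::finite \<Rightarrow> real"
  assumes f: "smooth_fun f"
  shows "((\<lambda>t. f (x + t *\<^sub>R u)) has_real_derivative (\<Sum>i\<in>UNIV. u $ i * pd i f (x + t *\<^sub>R u))) (at t)"
proof -
  have diff: "(\<lambda>t. f (x + t *\<^sub>R axis i 1)) differentiable (at 0)" for i x
    using f unfolding smooth_fun_def by (metis iter_pd.simps(1))
  have D: "(f has_derivative (\<lambda>v. \<Sum>i\<in>UNIV. v $ i * pd i f (x + t *\<^sub>R u))) (at (x + t *\<^sub>R u))"
    by (intro has_derivative_continuous_partials diff smooth_fun_continuous smooth_fun_pd f)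
  have "((\<lambda>t. x + t *\<^sub>R u) has_derivative (\<lambda>h. h *\<^sub>R u)) (at t)"
    by (auto intro!: derivative_eq_intros)
  from has_derivative_compose[OF this D]
  show ?thesis
    unfolding has_field_derivative_def
    by (rule back_subst[of "\<lambda>g. (_ has_derivative g) _"]) (auto simp: sum_distrib_left mult_ac)
qed

text \<open>The second derivative of \<open>f\<close> in direction \<open>u\<close>; summed over the
  rank-one terms of a matrix \<open>a\<close> it gives \<open>Lop a\<close>.\<close>

definition dir2 :: "real^'n::finite \<Rightarrow> (real^'n \<Rightarrow> real) \<Rightarrow> real^'n \<Rightarrow> real" where
  "dir2 u f x = (\<Sum>i\<in>UNIV. \<Sum>j\<in>UNIV. u $ i * u $ j * pd i (pd j f) x)"

text \<open>Taylor's formula of order two for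
  \<open>f (x + t *\<^sub>R u) + f (x - t *\<^sub>R u)\<close>, an even function of \<open>t\<close>
  whose first derivative vanishes at 0; hence one intermediate \<open>t\<close> serves both
  sides.\<close>

lemma second_difference:
  fixes f :: "real^'n::finite \<Rightarrow> real"
  assumes f: "smooth_fun f" and h: "0 < h"
  shows "\<exists>t. 0 < t \<and> t < h \<and> f (x + h *\<^sub>R u) + f (x - h *\<^sub>R u) - 2 * f x
     = h\<^sup>2 * (dir2 u f (x + t *\<^sub>R u) + dir2 u f (x - t *\<^sub>R u)) / 2"
proof -
  define g1 where "g1 u t = (\<Sum>i\<in>UNIV. u $ i * pd i f (x + t *\<^sub>R u))" for u :: "real^'n" and t
  define G where "G t = f (x + t *\<^sub>R u) + f (x + t *\<^sub>R (- u))" for t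
  define G1 where "G1 t = g1 u t + g1 (- u) t" for t
  define G2 where "G2 t = dir2 u f (x + t *\<^sub>R u) + dir2 (- u) f (x + t *\<^sub>R (- u))" for t
  have D: "(g1 u has_real_derivative dir2 u f (x + t *\<^sub>R u)) (at t)" for u t
  proof -
    have D: "(g1 u has_real_derivative (\<Sum>j\<in>UNIV. u $ j * (\<Sum>i\<in>UNIV. u $ i * pd i (pd j f) (x + t *\<^sub>R u)))) (at t)"
      unfolding g1_def
      by (intro DERIV_sum DERIV_cmult smooth_fun_DERIV_line smooth_fun_pd f)
    also have "(\<Sum>j\<in>UNIV. u $ j * (\<Sum>i\<in>UNIV. u $ i * pd i (pd j f) (x + t *\<^sub>R u))) = dir2 u f (x + t *\<^sub>R u)"
      unfolding dir2_def by (subst sum.swap) (simp add: sum_distrib_left mult_ac)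
    finally show ?thesis .
  qed
  have D2: "(G1 has_real_derivative G2 t) (at t)" for t
    unfolding G1_def G2_def by (intro DERIV_add D)
  have D1: "(G has_real_derivative G1 t) (at t)" for t
    unfolding G_def G1_def g1_def by (intro DERIV_add smooth_fun_DERIV_line f)
  define diff where "diff m = (if m = 0 then G else if m = 1 then G1 else G2)" for m :: nat
  have "\<forall>m t. m < 2 \<and> 0 \<le> t \<and> t \<le> h \<longrightarrow> (diff m has_real_derivative diff (Suc m) t) (at t)"
    using D1 D2 by (auto simp: diff_def less_2_cases_iff)
  then obtain t where t: "0 < t" "t < h"
    "G h = (\<Sum>m<2. diff m 0 / fact m * h ^ m) + diff 2 t / fact 2 * h ^ 2"
    using Maclaurin[OF h, of 2 diff G] by (auto simp: diff_def)
  have "dir2 (- u) f = dir2 u f" by (auto simp: dir2_def fun_eq_iff)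
  moreover have "G1 0 = 0" by (simp add: G1_def g1_def sum_negf)
  ultimately show ?thesis
    using t by (intro exI[of _ t]) (auto simp: diff_def G_def G2_def numeral_2_eq_2 field_simps)
qed

lemma compact_thickening_in_open:
  fixes K \<Omega> :: "'a::euclidean_space set"
  assumes "compact K" "open \<Omega>" "K \<subseteq> \<Omega>"
  obtains K' e where "compact K'" "K' \<subseteq> \<Omega>" "0 < e" "\<And>x v. x \<in> K \<Longrightarrow> norm v \<le> e \<Longrightarrow> x + v \<in> K'"
proof (cases "K = {}")
  case True
  then show ?thesis using that[of "{}" 1] by auto
next
  case False
  obtain e where e: "e > 0" "{x. infdist x K \<le> e} \<subseteq> \<Omega>"
    using compact_in_open_separated[OF False assms] by blast
  have "x + v \<in> {x. infdist x K \<le> e}" if "x \<in> K" "norm v \<le> e" for x v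
    using infdist_le2[OF that(1), of "x + v" e] that(2) by (auto simp: dist_norm)
  then show ?thesis
    using that[of "{x. infdist x K \<le> e}" e] e compact_infdist_le[OF False assms(1), of e] by auto
qed

lemma pd_eq_0_on_open:
  fixes f :: "real^'n::finite \<Rightarrow> real"
  assumes "open U" "\<And>x. x \<in> U \<Longrightarrow> f x = 0" "x \<in> U"
  shows "pd i f x = 0"
proof -
  have "open ((\<lambda>t::real. x + t *\<^sub>R axis i 1) -` U)"
    by (intro open_vimage assms(1) continuous_intros)
  moreover have "0 \<in> (\<lambda>t::real. x + t *\<^sub>R axis i 1) -` U" using assms(3) by simp
  ultimately have "eventually (\<lambda>t. t \<in> (\<lambda>t::real. x + t *\<^sub>R axis i 1) -` U) (nhds 0)"
    by (rule eventually_nhds_in_open)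
  then have "eventually (\<lambda>t. f (x + t *\<^sub>R axis i 1) = 0) (nhds 0)"
    by eventually_elim (auto intro: assms(2))
  then have "deriv (\<lambda>t. f (x + t *\<^sub>R axis i 1)) 0 = deriv (\<lambda>t. 0) 0"
    by (intro deriv_cong_ev) auto
  then show ?thesis by (simp add: pd_def)
qed

lemma continuous_on_dir2: "smooth_fun f \<Longrightarrow> continuous_on UNIV (dir2 u f)"
  unfolding dir2_def
  by (intro continuous_intros smooth_fun_continuous smooth_fun_pd)

lemma dir2_test_fun:
  assumes "test_fun \<Omega> \<psi>"
  shows "x \<notin> closure {x. \<psi> x \<noteq> 0} \<Longrightarrow> dir2 u \<psi> x = 0"
    and "\<exists>C. \<forall>x. \<bar>dir2 u \<psi> x\<bar> \<le> C"
proof -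
  let ?K = "closure {x. \<psi> x \<noteq> 0}"
  have 0: "\<psi> x = 0" if "x \<in> - ?K" for x using that closure_subset[of "{x. \<psi> x \<noteq> 0}"] by auto
  have 1: "pd j \<psi> x = 0" if "x \<in> - ?K" for x j
    by (rule pd_eq_0_on_open[OF _ 0 that]) auto
  have 2: "pd i (pd j \<psi>) x = 0" if "x \<in> - ?K" for x i j
    by (rule pd_eq_0_on_open[OF _ 1 that]) auto
  show z: "dir2 u \<psi> x = 0" if "x \<notin> ?K" for x
    using 2[of x] that by (simp add: dir2_def)
  have "compact (dir2 u \<psi> ` ?K)"
    using assms continuous_on_dir2[of \<psi> u] unfolding test_fun_def
    by (intro compact_continuous_image) (auto intro: continuous_on_subset)
  then obtain C where C: "\<And>x. x \<in> ?K \<Longrightarrow> norm (dir2 u \<psi> x) \<le> C"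
    by (meson bounded_iff compact_imp_bounded image_eqI)
  have "\<bar>dir2 u \<psi> x\<bar> \<le> max 0 C" for x
    using z[of x] C[of x] by (cases "x \<in> ?K") auto
  then show "\<exists>C. \<forall>x. \<bar>dir2 u \<psi> x\<bar> \<le> C" by blast
qed

text \<open>The bound does not depend on \<open>h\<close>, so it can serve as majorant for dominated
  convergence.\<close>

lemma second_quotient_bound:
  fixes f :: "real^'n::finite \<Rightarrow> real"
  assumes "smooth_fun f" "0 < h" and C: "\<And>x. \<bar>dir2 u f x\<bar> \<le> C"
  shows "\<bar>(f (x + h *\<^sub>R u) + f (x - h *\<^sub>R u) - 2 * f x) / h\<^sup>2\<bar> \<le> C"
proof -
  obtain t where "f (x + h *\<^sub>R u) + f (x - h *\<^sub>R u) - 2 * f x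
     = h\<^sup>2 * (dir2 u f (x + t *\<^sub>R u) + dir2 u f (x - t *\<^sub>R u)) / 2"
    using second_difference[OF assms(1,2)] by blast
  then have eq: "(f (x + h *\<^sub>R u) + f (x - h *\<^sub>R u) - 2 * f x) / h\<^sup>2
     = (dir2 u f (x + t *\<^sub>R u) + dir2 u f (x - t *\<^sub>R u)) / 2"
    using assms(2) by simp
  show ?thesis
    unfolding eq abs_le_iff using C[of "x + t *\<^sub>R u"] C[of "x - t *\<^sub>R u"]
    by (auto simp: abs_le_iff field_simps)
qed

lemma second_quotient_tendsto:
  fixes f :: "real^'n::finite \<Rightarrow> real"
  assumes f: "smooth_fun f" and h: "\<And>n. 0 < h n" "h \<longlonglongrightarrow> 0"
  shows "(\<lambda>n. (f (x + h n *\<^sub>R u) + f (x - h n *\<^sub>R u) - 2 * f x) / (h n)\<^sup>2) \<longlonglongrightarrow> dir2 u f x"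
proof -
  have "\<exists>t. \<forall>n. 0 < t n \<and> t n < h n \<and> f (x + h n *\<^sub>R u) + f (x - h n *\<^sub>R u) - 2 * f x
     = (h n)\<^sup>2 * (dir2 u f (x + t n *\<^sub>R u) + dir2 u f (x - t n *\<^sub>R u)) / 2"
    by (intro choice allI second_difference f h)
  then obtain t where t: "\<And>n. 0 < t n" "\<And>n. t n < h n"
    "\<And>n. f (x + h n *\<^sub>R u) + f (x - h n *\<^sub>R u) - 2 * f x
     = (h n)\<^sup>2 * (dir2 u f (x + t n *\<^sub>R u) + dir2 u f (x - t n *\<^sub>R u)) / 2"
    by blast
  have t0: "t \<longlonglongrightarrow> 0"
    by (rule tendsto_sandwich[OF _ _ tendsto_const h(2)])
       (auto intro!: always_eventually less_imp_le t)
  have cont: "isCont (dir2 u f) x"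
    using continuous_on_dir2[OF f, of u] by (simp add: continuous_on_eq_continuous_at)
  have "(\<lambda>n. x + t n *\<^sub>R u) \<longlonglongrightarrow> x + 0 *\<^sub>R u" "(\<lambda>n. x - t n *\<^sub>R u) \<longlonglongrightarrow> x - 0 *\<^sub>R u"
    by (intro tendsto_intros t0)+
  then have "(\<lambda>n. dir2 u f (x + t n *\<^sub>R u)) \<longlonglongrightarrow> dir2 u f x" "(\<lambda>n. dir2 u f (x - t n *\<^sub>R u)) \<longlonglongrightarrow> dir2 u f x"
    by (auto intro: isCont_tendsto_compose[OF cont])
  then have "(\<lambda>n. (dir2 u f (x + t n *\<^sub>R u) + dir2 u f (x - t n *\<^sub>R u)) / 2) \<longlonglongrightarrow> (dir2 u f x + dir2 u f x) / 2"
    by (intro tendsto_intros) auto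
  moreover have "(f (x + h n *\<^sub>R u) + f (x - h n *\<^sub>R u) - 2 * f x) / (h n)\<^sup>2
     = (dir2 u f (x + t n *\<^sub>R u) + dir2 u f (x - t n *\<^sub>R u)) / 2" for n
    using h(1)[of n] unfolding t(3) by simp
  ultimately show ?thesis by (simp only: mult_2[symmetric]) simp
qed

section \<open>From second differences to the inequality in the sense of distributions\<close>

lemma lborel_translation:
  fixes f :: "'a::euclidean_space \<Rightarrow> real"
  assumes [measurable]: "f \<in> borel_measurable borel"
  shows "integrable lborel (\<lambda>x. f (c + x)) \<longleftrightarrow> integrable lborel f"
    and "(\<integral>x. f (c + x) \<partial>lborel) = (\<integral>x. f x \<partial>lborel)"
proof -
  have "integrable (distr lborel borel ((+) c)) f \<longleftrightarrow> integrable lborel (\<lambda>x. f (c + x))"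
    by (intro integrable_distr_eq) auto
  then show "integrable lborel (\<lambda>x. f (c + x)) \<longleftrightarrow> integrable lborel f"
    by (simp add: lborel_distr_plus)
  have "(\<integral>x. f x \<partial>distr lborel borel ((+) c)) = (\<integral>x. f (c + x) \<partial>lborel)"
    by (intro integral_distr) auto
  then show "(\<integral>x. f (c + x) \<partial>lborel) = (\<integral>x. f x \<partial>lborel)"
    by (simp add: lborel_distr_plus)
qed

text \<open>A discrete integration by parts: translation invariance moves the second difference
  quotient from \<psi> to \<phi>, where \<open>diff\<close> gives its sign, and the step tends to
  zero on the side of \<psi>. So \<phi> itself is never differentiated.\<close>

lemma distrib_supersol_second_differences:
  fixes \<Omega> :: "(real^'n::finite) set" and u :: "'n \<Rightarrow> real^'n"
  assumes "open \<Omega>" and \<phi>[measurable]: "\<phi> \<in> borel_measurable borel"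
    and bdd: "\<And>K. compact K \<Longrightarrow> K \<subseteq> \<Omega> \<Longrightarrow> \<exists>B. \<forall>x\<in>K. \<bar>\<phi> x\<bar> \<le> B"
    and a: "\<And>i j. a $ i $ j = (\<Sum>k\<in>UNIV. u k $ i * u k $ j)"
    and diff: "\<And>K. compact K \<Longrightarrow> K \<subseteq> \<Omega> \<Longrightarrow> \<exists>h0>0. \<forall>x\<in>K. \<forall>h. 0 < h \<and> h < h0 \<longrightarrow>
       (\<Sum>k\<in>UNIV. \<phi> (x + h *\<^sub>R u k) + \<phi> (x - h *\<^sub>R u k) - 2 * \<phi> x) \<le> 0"
  shows "distrib_supersol a \<Omega> \<phi>"
  unfolding distrib_supersol_def
proof (intro allI impI)
  fix \<psi> :: "real^'n \<Rightarrow> real"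
  assume "test_fun \<Omega> \<psi> \<and> (\<forall>x. \<psi> x \<ge> 0)"
  then have test: "test_fun \<Omega> \<psi>" and pos: "\<And>x. \<psi> x \<ge> 0" by auto
  define K where "K = closure {x. \<psi> x \<noteq> 0}"
  have sm: "smooth_fun \<psi>" and K: "compact K" "K \<subseteq> \<Omega>"
    using test by (auto simp: test_fun_def K_def)
  have \<psi>0: "\<psi> x = 0" if "x \<notin> K" for x using that closure_subset[of "{x. \<psi> x \<noteq> 0}"] unfolding K_def by auto
  have [measurable]: "\<psi> \<in> borel_measurable borel"
    using smooth_fun_continuous[OF sm] by (rule borel_measurable_continuous_onI)
  have Lop: "Lop a \<psi> = (\<lambda>x. \<Sum>k\<in>UNIV. dir2 (u k) \<psi> x)"
  proof
    fix x
    have "Lop a \<psi> x = (\<Sum>i\<in>UNIV. \<Sum>j\<in>UNIV. \<Sum>k\<in>UNIV. u k $ i * u k $ j * pd i (pd j \<psi>) x)"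
      unfolding Lop_def a by (simp add: sum_distrib_right)
    also have "\<dots> = (\<Sum>i\<in>UNIV. \<Sum>k\<in>UNIV. \<Sum>j\<in>UNIV. u k $ i * u k $ j * pd i (pd j \<psi>) x)"
      by (intro sum.cong refl sum.swap)
    also have "\<dots> = (\<Sum>k\<in>UNIV. dir2 (u k) \<psi> x)"
      unfolding dir2_def by (rule sum.swap)
    finally show "Lop a \<psi> x = (\<Sum>k\<in>UNIV. dir2 (u k) \<psi> x)" .
  qed
  \<comment> \<open>Translates of \<psi> by vectors of length at most \<open>e\<close> are all
    supported in the fixed compact set \<open>K'\<close>, where \<phi> is bounded.\<close>
  obtain K' e where K': "compact K'" "K' \<subseteq> \<Omega>" "0 < e" "\<And>x v. x \<in> K \<Longrightarrow> norm v \<le> e \<Longrightarrow> x + v \<in> K'"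
    using compact_thickening_in_open[OF K(1) assms(1) K(2)] by blast
  have KK': "K \<subseteq> K'" using K'(4)[of _ 0] K'(3) by auto
  have [measurable]: "K' \<in> sets borel" "\<Omega> \<in> sets borel"
    using K'(1) assms(1) by (auto simp: borel_compact)
  have finK': "emeasure lborel K' < \<infinity>"
    using emeasure_bounded_finite[OF compact_imp_bounded[OF K'(1)]] by simp
  obtain B where B: "\<And>x. x \<in> K' \<Longrightarrow> \<bar>\<phi> x\<bar> \<le> B" using bdd[OF K'(1,2)] by blast
  have integrable_K': "integrable lborel (\<lambda>x. \<phi> x * g x)"
    if [measurable]: "g \<in> borel_measurable borel" and "\<And>x. \<bar>g x\<bar> \<le> G" "\<And>x. x \<notin> K' \<Longrightarrow> g x = 0" for g G
  proof (rule integrableI_bounded_set[of K' _ _ "B * G"])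
    show "AE x in lborel. x \<in> K' \<longrightarrow> norm (\<phi> x * g x) \<le> B * G"
      using B that(2) by (fastforce simp: abs_mult intro!: mult_mono)
    show "AE x in lborel. x \<notin> K' \<longrightarrow> \<phi> x * g x = 0" using that(3) by auto
  qed (use finK' in auto)
  have "\<exists>C. \<forall>k. \<forall>x. \<bar>dir2 (u k) \<psi> x\<bar> \<le> C k"
    by (intro choice allI dir2_test_fun(2)[OF test])
  then obtain C where C: "\<And>k x. \<bar>dir2 (u k) \<psi> x\<bar> \<le> C k" by blast
  obtain P where P: "\<And>x. \<bar>\<psi> x\<bar> \<le> P"
  proof -
    have "compact (\<psi> ` K)"
      using smooth_fun_continuous[OF sm] K(1)
      by (intro compact_continuous_image) (auto intro: continuous_on_subset)
    then obtain P where "\<And>x. x \<in> K \<Longrightarrow> norm (\<psi> x) \<le> P"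
      by (meson bounded_iff compact_imp_bounded image_eqI)
    then have "\<bar>\<psi> x\<bar> \<le> max 0 P" for x using \<psi>0[of x] by (cases "x \<in> K") fastforce+
    then show ?thesis using that by blast
  qed
  obtain h0 where h0: "h0 > 0" "\<And>x h. x \<in> K \<Longrightarrow> 0 < h \<Longrightarrow> h < h0 \<Longrightarrow>
       (\<Sum>k\<in>UNIV. \<phi> (x + h *\<^sub>R u k) + \<phi> (x - h *\<^sub>R u k) - 2 * \<phi> x) \<le> 0"
    using diff[OF K] by blast
  define L where "L = 1 + (\<Sum>k\<in>UNIV. norm (u k))"
  have L: "L > 0" "\<And>k. norm (u k) \<le> L"
  proof -
    show "L > 0" unfolding L_def by (intro add_pos_nonneg sum_nonneg) auto
    show "norm (u k) \<le> L" for k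
      using member_le_sum[of k UNIV "\<lambda>k. norm (u k)"] by (simp add: L_def)
  qed
  define h1 where "h1 = min h0 (e / L)"
  have h1: "h1 > 0" using h0(1) K'(3) L(1) by (simp add: h1_def)
  \<comment> \<open>\<open>n + 2\<close> keeps \<open>h n\<close> strictly below \<open>h1\<close>,
    hence below \<open>h0\<close>; the division by \<open>L\<close> in \<open>h1\<close> keeps each
    translation \<open>h n *\<^sub>R u k\<close> within length \<open>e\<close>.\<close>
  define h where "h n = h1 / real (n + 2)" for n
  have h: "0 < h n" "h n < h0" "h n * norm (u k) \<le> e" for n k
  proof -
    show hp: "0 < h n" using h1 by (simp add: h_def)
    have "h1 < h1 * real (n + 2)" using h1 by simp
    then have lt: "h n < h1" by (simp add: h_def field_simps)
    then show "h n < h0" by (simp add: h1_def)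
    have "h n * norm (u k) \<le> e / L * L"
      using lt hp L by (intro mult_mono) (auto simp: h1_def)
    then show "h n * norm (u k) \<le> e" using L(1) by simp
  qed
  have h_lim: "h \<longlonglongrightarrow> 0"
    unfolding h_def
    by (rule LIMSEQ_ignore_initial_segment[OF lim_const_over_n])
  define q where "q n k x = (\<psi> (x + h n *\<^sub>R u k) + \<psi> (x - h n *\<^sub>R u k) - 2 * \<psi> x) / (h n)\<^sup>2" for n k x
  have [measurable]: "q n k \<in> borel_measurable borel" for n k unfolding q_def by measurable
  have q_bound: "\<bar>q n k x\<bar> \<le> C k" for n k x
    unfolding q_def by (rule second_quotient_bound[OF sm h(1) C])
  have outside: "\<psi> (x + v) = 0" if "x \<notin> K'" "norm v \<le> e" for x v
    using K'(4)[of "x + v" "- v"] that \<psi>0[of "x + v"] by auto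
  have q_0: "q n k x = 0" if "x \<notin> K'" for n k x
    using outside[OF that, of "h n *\<^sub>R u k"] outside[OF that, of "- h n *\<^sub>R u k"] outside[OF that, of 0]
      h(1)[of n] h(3)[of n k] K'(3) by (simp add: q_def)
  have d_0: "dir2 (u k) \<psi> x = 0" if "x \<notin> K'" for k x
    using dir2_test_fun(1)[OF test] that KK' by (auto simp: K_def)
  have [measurable]: "dir2 (u k) \<psi> \<in> borel_measurable borel" for k
    using continuous_on_dir2[OF sm] by (rule borel_measurable_continuous_onI)
  have C_bound: "\<bar>\<Sum>k\<in>UNIV. g k\<bar> \<le> (\<Sum>k\<in>UNIV. C k)" if "\<And>k. \<bar>g k\<bar> \<le> C k" for g :: "'n \<Rightarrow> real"
    by (rule order_trans[OF sum_abs sum_mono]) (rule that)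
  \<comment> \<open>The majorant is \<phi> in absolute value times the constant sum of the
    \<open>C k\<close>, cut off to \<open>K'\<close>.\<close>
  have conv: "(\<lambda>n. \<integral>x. \<phi> x * (\<Sum>k\<in>UNIV. q n k x) \<partial>lborel) \<longlonglongrightarrow> (\<integral>x. \<phi> x * Lop a \<psi> x \<partial>lborel)"
  proof (rule integral_dominated_convergence)
    show "integrable lborel (\<lambda>x. \<bar>\<phi> x * (indicator K' x * (\<Sum>k\<in>UNIV. C k))\<bar>)"
      by (intro integrable_abs integrable_K'[where G="\<bar>\<Sum>k\<in>UNIV. C k\<bar>"]) (auto split: split_indicator)
    show "AE x in lborel. (\<lambda>n. \<phi> x * (\<Sum>k\<in>UNIV. q n k x)) \<longlonglongrightarrow> \<phi> x * Lop a \<psi> x"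
      unfolding Lop q_def
      by (intro always_eventually allI tendsto_intros second_quotient_tendsto sm h(1) h_lim)
    have "norm (\<phi> x * (\<Sum>k\<in>UNIV. q n k x)) \<le> \<bar>\<phi> x * (indicator K' x * (\<Sum>k\<in>UNIV. C k))\<bar>" for n x
      using C_bound[of "\<lambda>k. q n k x", OF q_bound] q_0[of x n]
      by (cases "x \<in> K'") (auto simp: abs_mult intro!: mult_left_mono)
    then show "AE x in lborel. norm (\<phi> x * (\<Sum>k\<in>UNIV. q n k x)) \<le> \<bar>\<phi> x * (indicator K' x * (\<Sum>k\<in>UNIV. C k))\<bar>" for n
      by simp
  qed (auto simp: Lop)
  have trans: "integrable lborel (\<lambda>x. \<phi> x * \<psi> (x + v))" "integrable lborel (\<lambda>x. \<phi> (x - v) * \<psi> x)"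
    "(\<integral>x. \<phi> x * \<psi> (x + v) \<partial>lborel) = (\<integral>x. \<phi> (x - v) * \<psi> x \<partial>lborel)" if "norm v \<le> e" for v
  proof -
    show i: "integrable lborel (\<lambda>x. \<phi> x * \<psi> (x + v))"
      by (rule integrable_K'[where G=P]) (auto simp: P outside that)
    show "integrable lborel (\<lambda>x. \<phi> (x - v) * \<psi> x)"
      using lborel_translation(1)[of "\<lambda>x. \<phi> (x - v) * \<psi> x" v] i by (simp add: add.commute)
    show "(\<integral>x. \<phi> x * \<psi> (x + v) \<partial>lborel) = (\<integral>x. \<phi> (x - v) * \<psi> x \<partial>lborel)"
      using lborel_translation(2)[of "\<lambda>x. \<phi> (x - v) * \<psi> x" v] by (simp add: add.commute)
  qed
  have "(\<integral>x. \<phi> x * (\<Sum>k\<in>UNIV. q n k x) \<partial>lborel) \<le> 0" for n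
  proof -
    have n1: "norm (h n *\<^sub>R u k) \<le> e" "norm (- h n *\<^sub>R u k) \<le> e" "norm (0::real^'n) \<le> e" for k
      using h(1)[of n] h(3)[of n k] K'(3) by auto
    \<comment> \<open>The shifts by 0 below stay unsimplified so that all three terms match
      \<open>trans\<close>.\<close>
    note t1 = trans[OF n1(1)] and t2 = trans[OF n1(2)] and t3 = trans[OF n1(3)]
    have "(\<integral>x. \<phi> x * (\<Sum>k\<in>UNIV. q n k x) \<partial>lborel)
      = (\<integral>x. (\<Sum>k\<in>UNIV. (\<phi> x * \<psi> (x + h n *\<^sub>R u k) + \<phi> x * \<psi> (x + - h n *\<^sub>R u k) - 2 * (\<phi> x * \<psi> (x + 0)))) / (h n)\<^sup>2 \<partial>lborel)"
      unfolding q_def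
      by (intro Bochner_Integration.integral_cong refl)
         (simp add: sum_distrib_left sum_divide_distrib algebra_simps)
    also have "\<dots> = (\<Sum>k\<in>UNIV. (\<integral>x. \<phi> x * \<psi> (x + h n *\<^sub>R u k) \<partial>lborel) + (\<integral>x. \<phi> x * \<psi> (x + - h n *\<^sub>R u k) \<partial>lborel)
        - 2 * (\<integral>x. \<phi> x * \<psi> (x + 0) \<partial>lborel)) / (h n)\<^sup>2"
      using t1 t2 t3 by (simp del: scaleR_minus_left add_uminus_conv_diff add_0_right)
    also have "\<dots> = (\<Sum>k\<in>UNIV. (\<integral>x. \<phi> (x - h n *\<^sub>R u k) * \<psi> x \<partial>lborel) + (\<integral>x. \<phi> (x - - h n *\<^sub>R u k) * \<psi> x \<partial>lborel)
        - 2 * (\<integral>x. \<phi> (x - 0) * \<psi> x \<partial>lborel)) / (h n)\<^sup>2"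
      unfolding t1 t2 t3 ..
    also have "\<dots> = (\<integral>x. (\<Sum>k\<in>UNIV. \<phi> (x - h n *\<^sub>R u k) * \<psi> x + \<phi> (x - - h n *\<^sub>R u k) * \<psi> x - 2 * (\<phi> (x - 0) * \<psi> x)) / (h n)\<^sup>2 \<partial>lborel)"
      using t1 t2 t3 by (simp del: scaleR_minus_left diff_minus_eq_add diff_0_right)
    also have "\<dots> \<le> (\<integral>x. 0 \<partial>(lborel :: (real^'n) measure))"
    proof (rule integral_mono)
      show "integrable lborel (\<lambda>x. (\<Sum>k\<in>UNIV. \<phi> (x - h n *\<^sub>R u k) * \<psi> x + \<phi> (x - - h n *\<^sub>R u k) * \<psi> x - 2 * (\<phi> (x - 0) * \<psi> x)) / (h n)\<^sup>2)"
        using t1 t2 t3 by (intro integrable_divide_zero impI Bochner_Integration.integrable_sum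
            Bochner_Integration.integrable_add Bochner_Integration.integrable_diff integrable_mult_right)
      fix x
      have "(\<Sum>k\<in>UNIV. \<phi> (x - h n *\<^sub>R u k) * \<psi> x + \<phi> (x - - h n *\<^sub>R u k) * \<psi> x - 2 * (\<phi> (x - 0) * \<psi> x))
        = (\<Sum>k\<in>UNIV. \<phi> (x + h n *\<^sub>R u k) + \<phi> (x - h n *\<^sub>R u k) - 2 * \<phi> x) * \<psi> x"
        unfolding sum_distrib_right by (intro sum.cong refl) (simp add: algebra_simps)
      \<comment> \<open>On \<open>K\<close> the second difference of \<phi> is nonpositive and
        \<psi> is nonnegative; off \<open>K\<close> the factor \<psi> is zero.\<close>
      also have "\<dots> \<le> 0"
        using h0(2)[OF _ h(1,2), of x n] pos[of x] \<psi>0[of x]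
        by (cases "x \<in> K") (auto intro: mult_nonpos_nonneg)
      finally show "(\<Sum>k\<in>UNIV. \<phi> (x - h n *\<^sub>R u k) * \<psi> x + \<phi> (x - - h n *\<^sub>R u k) * \<psi> x - 2 * (\<phi> (x - 0) * \<psi> x)) / (h n)\<^sup>2 \<le> 0"
        by (simp add: divide_nonpos_nonneg)
    qed simp
    finally show ?thesis by simp
  qed
  then have le: "(\<integral>x. \<phi> x * Lop a \<psi> x \<partial>lborel) \<le> 0"
    by (intro LIMSEQ_le_const2[OF conv]) auto
  have "Lop a \<psi> x = 0" if "x \<notin> \<Omega>" for x
  proof -
    have "x \<notin> K'" using that K'(2) by blast
    then show ?thesis by (simp add: Lop d_0)
  qed
  then have eq: "(\<lambda>x. indicator \<Omega> x *\<^sub>R (\<phi> x * Lop a \<psi> x)) = (\<lambda>x. \<phi> x * Lop a \<psi> x)"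
    by (auto simp: fun_eq_iff split: split_indicator)
  have "integrable lborel (\<lambda>x. \<phi> x * Lop a \<psi> x)"
    unfolding Lop
    by (rule integrable_K'[where G="\<Sum>k\<in>UNIV. C k"]) (auto simp: d_0 intro!: C_bound C)
  then show "set_integrable lborel \<Omega> (\<lambda>x. \<phi> x * Lop a \<psi> x) \<and> (LINT x:\<Omega>|lborel. \<phi> x * Lop a \<psi> x) \<le> 0"
    using le unfolding set_integrable_def set_lebesgue_integral_def eq by simp
qed

section \<open>Quadratic barriers\<close>

text \<open>The \<open>ER\<close> condition for the one component that contains \<open>x\<close>,
  with a fixed direction \<open>e\<close>; it ties each barrier to the points at which it may be
  used.\<close>

definition admissible :: "(real^'n::finite) set \<Rightarrow> real \<Rightarrow> real^'n \<Rightarrow> real \<Rightarrow> real^'n \<Rightarrow> real^'n \<Rightarrow> bool" where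
  "admissible \<Omega> \<delta> p R e x \<longleftrightarrow> norm e = 1 \<and> x \<in> \<Omega> \<inter> ball p R \<and>
     connected_component_set (\<Omega> \<inter> ball p R) x \<subseteq> {y. (y - p) \<bullet> e < \<delta> * R}"

definition barrier :: "real \<Rightarrow> real \<Rightarrow> real^'n::finite \<Rightarrow> real \<Rightarrow> real^'n \<Rightarrow> real^'n \<Rightarrow> real" where
  "barrier D \<delta> p R e x =
     D * (2 * \<delta> - (x - p) \<bullet> e / R - ((x - p) \<bullet> e / R)\<^sup>2) + (norm (x - p) / R)\<^sup>2"

lemma admissible_same_component:
  assumes "admissible \<Omega> \<delta> p R e x" "y \<in> connected_component_set (\<Omega> \<inter> ball p R) x"
  shows "admissible \<Omega> \<delta> p R e y"
  using assms connected_component_eq[OF assms(2)] connected_component_in[of "\<Omega> \<inter> ball p R" x y]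
  unfolding admissible_def by simp

text \<open>Admissibility for fixed \<open>p\<close>, \<open>R\<close>, \<open>e\<close> holds on
  whole components at once, and these are open. This later gives measurability of an infimum over
  uncountably many barriers.\<close>

lemma open_admissible:
  assumes "open \<Omega>"
  shows "open {x. admissible \<Omega> \<delta> p R e x}"
proof (rule openI, clarify)
  fix x assume x: "admissible \<Omega> \<delta> p R e x"
  let ?C = "connected_component_set (\<Omega> \<inter> ball p R) x"
  have "open ?C" using assms by (intro open_connected_component) auto
  moreover have "x \<in> ?C" using x by (auto simp: admissible_def)
  ultimately obtain r where r: "r > 0" "ball x r \<subseteq> ?C" by (meson openE)
  then have "ball x r \<subseteq> {x. admissible \<Omega> \<delta> p R e x}"
    using admissible_same_component[OF x] by blast
  then show "\<exists>r>0. ball x r \<subseteq> {x. admissible \<Omega> \<delta> p R e x}" using r(1) by blast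
qed

text \<open>A ball about \<open>x\<close> that leaves \<open>\<Omega>\<close> is connected and so
  meets the frontier, closer to \<open>x\<close> than \<open>bdist\<close> permits.\<close>

lemma ball_bdist_subset:
  assumes "x \<in> \<Omega>"
  shows "ball x (bdist \<Omega> x) \<subseteq> \<Omega>"
proof (rule ccontr)
  assume "\<not> ?thesis"
  then have "ball x (bdist \<Omega> x) - \<Omega> \<noteq> {}" by auto
  moreover from this have "ball x (bdist \<Omega> x) \<noteq> {}" by blast
  then have "0 < bdist \<Omega> x" by (simp add: ball_eq_empty)
  then have "ball x (bdist \<Omega> x) \<inter> \<Omega> \<noteq> {}" using assms centre_in_ball by blast
  ultimately have "ball x (bdist \<Omega> x) \<inter> frontier \<Omega> \<noteq> {}"
    by (intro connected_Int_frontier connected_ball)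
  then obtain y where "dist x y < bdist \<Omega> x" "y \<in> frontier \<Omega>" by auto
  then show False using infdist_le[of y "frontier \<Omega>" x] by (simp add: bdist_def)
qed

text \<open>Since \<open>bdist \<Omega> x \<le> norm (x - p) < R / 2\<close>, the ball of radius
  \<open>bdist \<Omega> x\<close> about \<open>x\<close> lies in
  \<open>\<Omega> \<inter> ball p R\<close>; being connected, it lies in the component of
  \<open>x\<close>.\<close>

lemma admissible_near:
  assumes adm: "admissible \<Omega> \<delta> p R e x" and "p \<in> frontier \<Omega>"
    and "2 * norm (x - p) < R" "norm v < bdist \<Omega> x"
  shows "admissible \<Omega> \<delta> p R e (x + v)"
proof (rule admissible_same_component[OF adm])
  have x: "x \<in> \<Omega>" using adm by (simp add: admissible_def)
  have le: "bdist \<Omega> x \<le> norm (x - p)"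
    using infdist_le[OF assms(2), of x] by (simp add: bdist_def dist_norm)
  have "ball x (bdist \<Omega> x) \<subseteq> ball p R"
  proof
    fix y assume "y \<in> ball x (bdist \<Omega> x)"
    then have "dist p y < norm (x - p) + norm (x - p)"
      using dist_triangle[of p y x] le by (auto simp: dist_norm norm_minus_commute)
    then show "y \<in> ball p R" using assms(3) by simp
  qed
  then have "ball x (bdist \<Omega> x) \<subseteq> connected_component_set (\<Omega> \<inter> ball p R) x"
    using ball_bdist_subset[OF x] le_less_trans[OF norm_ge_zero assms(4)]
    by (intro connected_component_maximal connected_ball) (simp_all only: centre_in_ball le_inf_iff)
  moreover have "x + v \<in> ball x (bdist \<Omega> x)" using assms(4) by (simp add: dist_norm)
  ultimately show "x + v \<in> connected_component_set (\<Omega> \<inter> ball p R) x" by blast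
qed

text \<open>The infimum in \<open>delta_Omega\<close> need not be attained, so the aperture is
  doubled to leave room for some \<open>d < 2 * \<delta>\<close>.\<close>

lemma delta_Omega_admissible:
  assumes "delta_Omega \<Omega> R \<le> \<delta>" "0 < \<delta>" "0 < R" "p \<in> frontier \<Omega>" "x \<in> \<Omega> \<inter> ball p R"
  shows "\<exists>e. admissible \<Omega> (2 * \<delta>) p R e x"
proof -
  \<comment> \<open>Any unit vector shows \<open>(1, R) \<in> ER \<Omega>\<close>, so the infimum is
    over a nonempty set.\<close>
  obtain e1 :: "real^'a" where e1: "norm e1 = 1" using vector_choose_size[of 1] by auto
  have "(x - p) \<bullet> e1 < R" if "x \<in> ball p R" for x p
    using norm_cauchy_schwarz[of "x - p" e1] that e1 by (simp add: dist_norm norm_minus_commute)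
  then have "C \<subseteq> {x \<in> ball p R. (x - p) \<bullet> e1 < 1 * R}" if "C \<in> components (\<Omega> \<inter> ball p R)" for C p
    using in_components_subset[OF that] by auto
  then have "(1, R) \<in> ER \<Omega>"
    using assms(3) e1 unfolding ER_def by (simp add: subset_iff) blast
  then have ne: "{\<delta>. (\<delta>, R) \<in> ER \<Omega>} \<noteq> {}" by blast
  have "Inf {\<delta>. (\<delta>, R) \<in> ER \<Omega>} < 2 * \<delta>"
    using assms(1,2) by (simp add: delta_Omega_def)
  then obtain d where d: "(d, R) \<in> ER \<Omega>" "d < 2 * \<delta>"
    using cInf_lessD[OF ne] by blast
  have "connected_component_set (\<Omega> \<inter> ball p R) x \<in> components (\<Omega> \<inter> ball p R)"
    using assms(5) by (auto simp: components_def)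
  then obtain e where e: "norm e = 1"
    "connected_component_set (\<Omega> \<inter> ball p R) x \<subseteq> {x\<in>ball p R. (x - p) \<bullet> e < d * R}"
    using d(1) assms(4) unfolding ER_def by blast
  moreover have "d * R < 2 * \<delta> * R" using d(2) assms(3) by simp
  ultimately show ?thesis
    using assms(5) unfolding admissible_def by (intro exI[of _ e]) fastforce
qed

text \<open>Here \<open>-1 < s < \<delta>\<close>. For \<open>s \<le> 0\<close> the part
  \<open>- s - s\<^sup>2\<close> is nonnegative; for \<open>s > 0\<close> the term
  \<open>2 * \<delta>\<close> absorbs \<open>s < \<delta>\<close> and
  \<open>s\<^sup>2 \<le> \<delta> / 2\<close>. At least \<open>\<delta> / 2\<close> remains in both
  cases.\<close>

lemma barrier_lower:
  assumes "admissible \<Omega> \<delta> p R e x" "0 \<le> \<delta>" "\<delta> \<le> 1/2" "0 < R" "0 \<le> D"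
  shows "D * \<delta> / 2 + (norm (x - p) / R)\<^sup>2 \<le> barrier D \<delta> p R e x"
proof -
  define s where "s = (x - p) \<bullet> e / R"
  have e: "norm e = 1" and x: "x \<in> \<Omega> \<inter> ball p R" using assms(1) by (auto simp: admissible_def)
  have "(x - p) \<bullet> e < \<delta> * R"
    using assms(1) connected_component_refl[OF x] unfolding admissible_def by blast
  then have s: "s < \<delta>" using assms(4) by (simp add: s_def field_simps)
  have "- ((x - p) \<bullet> e) < R"
    using norm_cauchy_schwarz[of "p - x" e] e x by (simp add: dist_norm inner_diff_left)
  then have s1: "-1 < s" using assms(4) by (simp add: s_def field_simps)
  have "\<delta> / 2 \<le> 2 * \<delta> - s - s\<^sup>2"
  proof (cases "s \<le> 0")
    case True
    then have "s * (1 + s) \<le> 0" using s1 by (intro mult_nonpos_nonneg) auto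
    then show ?thesis using assms(2) by (simp add: power2_eq_square algebra_simps)
  next
    case False
    then have "s\<^sup>2 \<le> \<delta> * (1/2)"
      using s assms(3) unfolding power2_eq_square by (intro mult_mono) auto
    then show ?thesis using s by simp
  qed
  then have "D * (\<delta> / 2) \<le> D * (2 * \<delta> - s - s\<^sup>2)" by (rule mult_left_mono[OF _ assms(5)])
  then show ?thesis by (simp add: barrier_def s_def)
qed

lemma barrier_upper:
  assumes "norm e = 1" "norm (x - p) / R \<le> c" "0 < R" "0 \<le> D"
  shows "barrier D \<delta> p R e x \<le> D * (2 * \<delta> + c) + c\<^sup>2"
proof -
  define s where "s = (x - p) \<bullet> e / R"
  have "\<bar>(x - p) \<bullet> e\<bar> \<le> norm (x - p)"
    using Cauchy_Schwarz_ineq2[of "x - p" e] assms(1) by simp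
  then have "\<bar>s\<bar> \<le> norm (x - p) / R" using assms(3) by (simp add: s_def divide_right_mono)
  then have "2 * \<delta> - s - s\<^sup>2 \<le> 2 * \<delta> + c"
    using assms(2) zero_le_power2[of s] by linarith
  then have "D * (2 * \<delta> - s - s\<^sup>2) \<le> D * (2 * \<delta> + c)"
    by (rule mult_left_mono[OF _ assms(4)])
  moreover have "(norm (x - p) / R)\<^sup>2 \<le> c\<^sup>2"
    using assms(2,3) by (intro power_mono) auto
  ultimately show ?thesis
    unfolding barrier_def s_def by (rule add_mono)
qed

text \<open>Exact, because the barrier is quadratic: linear terms cancel and the norms combine by
  the parallelogram law. The result does not depend on \<open>x\<close>, so its sign after summation
  depends only on the vectors \<open>v\<close> and on \<open>e\<close>.\<close>

lemma barrier_second_difference: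
  "barrier D \<delta> p R e (x + v) + barrier D \<delta> p R e (x - v) - 2 * barrier D \<delta> p R e x
     = 2 * ((norm v)\<^sup>2 - D * (v \<bullet> e)\<^sup>2) / R\<^sup>2"
proof -
  define y where "y = x - p"
  define s where "s = y \<bullet> e / R"
  define w where "w = v \<bullet> e / R"
  have par: "(norm (y + v))\<^sup>2 + (norm (y - v))\<^sup>2 = 2 * (norm y)\<^sup>2 + 2 * (norm v)\<^sup>2"
    by (simp add: power2_norm_eq_inner inner_simps)
  have n: "(norm (y + v) / R)\<^sup>2 + (norm (y - v) / R)\<^sup>2 = 2 * (norm y / R)\<^sup>2 + 2 * (norm v)\<^sup>2 / R\<^sup>2"
    unfolding power_divide add_divide_distrib[symmetric] par by (simp add: add_divide_distrib)
  have plus: "x + v - p = (x - p) + v" and minus: "x - v - p = (x - p) - v" by simp_all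
  have "barrier D \<delta> p R e (x + v) = D * (2 * \<delta> - (s + w) - (s + w)\<^sup>2) + (norm (y + v) / R)\<^sup>2"
    "barrier D \<delta> p R e (x - v) = D * (2 * \<delta> - (s - w) - (s - w)\<^sup>2) + (norm (y - v) / R)\<^sup>2"
    "barrier D \<delta> p R e x = D * (2 * \<delta> - s - s\<^sup>2) + (norm y / R)\<^sup>2"
    unfolding barrier_def plus minus inner_add_left inner_diff_left add_divide_distrib diff_divide_distrib
      s_def w_def y_def by (rule refl)+
  moreover have "D * (2 * \<delta> - (s + w) - (s + w)\<^sup>2) + D * (2 * \<delta> - (s - w) - (s - w)\<^sup>2)
      - 2 * (D * (2 * \<delta> - s - s\<^sup>2)) = - 2 * D * w\<^sup>2"
    by (simp add: power2_eq_square algebra_simps)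
  moreover have "2 * ((norm v)\<^sup>2 - D * (v \<bullet> e)\<^sup>2) / R\<^sup>2 = 2 * (norm v)\<^sup>2 / R\<^sup>2 - 2 * D * w\<^sup>2"
    by (simp add: w_def power_divide right_diff_distrib diff_divide_distrib)
  ultimately show ?thesis using n by linarith
qed

section \<open>The infimum of the barriers over boundary points, scales and directions\<close>

locale barrier_scales =
  fixes \<Omega> :: "(real^'n::finite) set" and R0 Rinf \<alpha> D M :: real
  assumes open_dom: "open \<Omega>" and frontier_ne: "frontier \<Omega> \<noteq> {}"
    and R0: "0 < R0" "R0 \<le> Rinf" and \<alpha>: "0 < \<alpha>" and D: "1 \<le> D" and M: "2 \<le> M"
    and decay: "12 * D * M powr \<alpha> \<le> M"
    and admissible_ex: "\<And>p R x. p \<in> frontier \<Omega> \<Longrightarrow> 0 < R \<Longrightarrow> R \<le> R0 \<or> Rinf \<le> R \<Longrightarrow> x \<in> \<Omega> \<inter> ball p R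
       \<Longrightarrow> \<exists>e. admissible \<Omega> (1 / (2 * M)) p R e x"
begin

text \<open>The factor on small scales lifts them above the first large scale \<open>M * Rinf\<close>, so that the
  infimum may skip the uncontrolled scales between \<open>R0\<close> and \<open>Rinf\<close>.\<close>
definition weight :: "real \<Rightarrow> real" where
  "weight R = (if R \<le> R0 then (M * Rinf / R0) powr \<alpha> else 1) * R powr \<alpha>"

definition candidate :: "real^'n \<Rightarrow> real \<Rightarrow> real^'n \<Rightarrow> real^'n \<Rightarrow> bool" where
  "candidate p R e x \<longleftrightarrow> p \<in> frontier \<Omega> \<and> 0 < R \<and> (R \<le> R0 \<or> Rinf \<le> R) \<and> admissible \<Omega> (1 / (2 * M)) p R e x"

definition cvalue :: "real^'n \<Rightarrow> real \<Rightarrow> real^'n \<Rightarrow> real^'n \<Rightarrow> real" where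
  "cvalue p R e x = weight R * barrier D (1 / (2 * M)) p R e x"

text \<open>The value 0 off \<open>\<Omega>\<close> makes this a Borel function on the whole space,
  as translation under the integral requires.\<close>

definition phi :: "real^'n \<Rightarrow> real" where
  "phi x = (if x \<in> \<Omega> then Inf {cvalue p R e x |p R e. candidate p R e x} else 0)"

lemma weight_factor: "1 \<le> (M * Rinf / R0) powr \<alpha>"
proof -
  have "1 * 1 \<le> M * (Rinf / R0)" using M R0 by (intro mult_mono) auto
  then show ?thesis using \<alpha> by (intro ge_one_powr_ge_zero) auto
qed

lemma weight_bounds:
  assumes "0 < R"
  shows "R powr \<alpha> \<le> weight R" "weight R \<le> (M * Rinf / R0) powr \<alpha> * R powr \<alpha>" "0 < weight R"
proof -
  show 1: "R powr \<alpha> \<le> weight R" "weight R \<le> (M * Rinf / R0) powr \<alpha> * R powr \<alpha>"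
    using weight_factor mult_right_mono[OF weight_factor, of "R powr \<alpha>"] by (auto simp: weight_def)
  show "0 < weight R" using 1(1) assms by (smt (verit) powr_gt_zero)
qed

lemma candidate_scale:
  assumes "candidate p R e x"
  shows "0 < R" "x \<in> \<Omega>" "norm (x - p) < R" "bdist \<Omega> x \<le> norm (x - p)" "norm e = 1" "p \<in> frontier \<Omega>"
  using assms infdist_le[of p "frontier \<Omega>" x]
  by (auto simp: candidate_def admissible_def bdist_def dist_norm norm_minus_commute)

lemma candidate_barrier_lower:
  assumes "candidate p R e x"
  shows "D / (4 * M) + (norm (x - p) / R)\<^sup>2 \<le> barrier D (1 / (2 * M)) p R e x"
  using barrier_lower[of \<Omega> "1 / (2 * M)" p R e x D] assms D M
  by (auto simp: candidate_def field_simps)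

lemma candidate_barrier_upper:
  assumes "candidate p R e x"
  shows "barrier D (1 / (2 * M)) p R e x \<le> 3 * D"
proof -
  have "barrier D (1 / (2 * M)) p R e x \<le> D * (2 * (1 / (2 * M)) + 1) + 1\<^sup>2"
    using candidate_scale[OF assms] D by (intro barrier_upper) auto
  also have "\<dots> \<le> D * (1/2 + 1) + 1"
    using D M by (intro add_mono mult_left_mono) (auto simp: field_simps)
  finally show ?thesis using D by simp
qed

text \<open>A candidate satisfies \<open>bdist \<Omega> x \<le> norm (x - p) < R\<close>, so
  \<open>R powr \<alpha>\<close> dominates \<open>bdist \<Omega> x powr \<alpha>\<close>; the
  barrier contributes the constant \<open>D / (4 * M)\<close>.\<close>

lemma candidate_value_lower:
  assumes "candidate p R e x"
  shows "D / (4 * M) * bdist \<Omega> x powr \<alpha> \<le> cvalue p R e x"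
proof -
  note c = candidate_scale[OF assms]
  have "D / (4 * M) \<le> barrier D (1 / (2 * M)) p R e x"
    using candidate_barrier_lower[OF assms] zero_le_power2[of "norm (x - p) / R"] by linarith
  moreover have "bdist \<Omega> x powr \<alpha> \<le> weight R"
    using weight_bounds(1)[OF c(1)] c \<alpha> powr_mono2[of \<alpha> "bdist \<Omega> x" R]
    by (force simp: bdist_def infdist_nonneg)
  ultimately have "D / (4 * M) * bdist \<Omega> x powr \<alpha> \<le> barrier D (1 / (2 * M)) p R e x * weight R"
    using D M by (intro mult_mono) (auto intro: order_trans[rotated])
  then show ?thesis by (simp add: cvalue_def mult.commute)
qed

lemma candidate_value_nonneg:
  assumes "candidate p R e x"
  shows "0 \<le> cvalue p R e x"
proof -
  have "0 \<le> D / (4 * M) * bdist \<Omega> x powr \<alpha>" using D M by simp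
  then show ?thesis using candidate_value_lower[OF assms] by linarith
qed

lemma bdd_below_values: "bdd_below {cvalue p R e x |p R e. candidate p R e x}"
  using candidate_value_nonneg by (intro bdd_belowI[of _ 0]) auto

lemma phi_le: "candidate p R e x \<Longrightarrow> phi x \<le> cvalue p R e x"
  using candidate_scale(2) bdd_below_values unfolding phi_def
  by (auto intro!: cInf_lower)

text \<open>The witness is a nearest boundary point at a scale comparable to its distance. Of the
  two ratio factors, the first bounds \<open>weight\<close> and the second bounds the scale by the
  distance.\<close>

lemma candidate_ex:
  assumes "x \<in> \<Omega>"
  obtains p R e where "candidate p R e x"
    "cvalue p R e x \<le> 3 * D * (M * Rinf / R0) powr \<alpha> * (2 * Rinf / R0) powr \<alpha> * bdist \<Omega> x powr \<alpha>"
proof -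
  define p where "p = closest_point (frontier \<Omega>) x"
  have p: "p \<in> frontier \<Omega>" "\<And>y. y \<in> frontier \<Omega> \<Longrightarrow> dist x p \<le> dist x y"
    using closest_point_exists[OF frontier_closed frontier_ne] by (auto simp: p_def)
  define t where "t = bdist \<Omega> x"
  have t: "dist x p = t"
    unfolding t_def bdist_def infdist_notempty[OF frontier_ne]
    using p by (intro antisym cINF_greatest frontier_ne cINF_lower bdd_belowI2[of _ 0]) auto
  have "x \<notin> frontier \<Omega>" using assms open_dom by (simp add: frontier_def interior_open)
  then have t0: "t > 0" using p(1) t by (metis zero_less_dist_iff)
  \<comment> \<open>Twice the distance keeps \<open>x\<close> inside the ball; in the gap between
    \<open>R0\<close> and \<open>Rinf\<close> the next controlled scale is
    \<open>Rinf\<close>.\<close>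
  define R where "R = (if 2 * t \<le> R0 \<or> Rinf \<le> 2 * t then 2 * t else Rinf)"
  have ratio: "1 \<le> Rinf / R0" using R0 by simp
  have R: "0 < R" "R \<le> R0 \<or> Rinf \<le> R" "t < R" using t0 R0 by (auto simp: R_def)
  have Rle: "R \<le> 2 * Rinf / R0 * t"
  proof (cases "2 * t \<le> R0 \<or> Rinf \<le> 2 * t")
    case True
    then show ?thesis using mult_right_mono[OF ratio, of "2 * t"] t0 by (simp add: R_def mult_ac)
  next
    case False
    \<comment> \<open>In the gap \<open>R0 < 2 * t\<close>, so the jump to \<open>Rinf\<close> costs
      at most the factor \<open>Rinf / R0\<close>.\<close>
    then have "Rinf * R0 \<le> Rinf * (2 * t)" using R0 by (intro mult_left_mono) auto
    then show ?thesis using False R0 by (simp add: R_def field_simps)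
  qed
  obtain e where "admissible \<Omega> (1 / (2 * M)) p R e x"
    using admissible_ex[OF p(1) R(1,2), of x] assms R(3) t by (auto simp: dist_commute)
  then have c: "candidate p R e x" using p(1) R by (simp add: candidate_def)
  have le: "cvalue p R e x \<le> ((M * Rinf / R0) powr \<alpha> * R powr \<alpha>) * (3 * D)"
    unfolding cvalue_def
    using weight_bounds[OF R(1)] candidate_barrier_upper[OF c] candidate_barrier_lower[OF c] D M
    by (intro mult_mono) (auto intro: order_trans[rotated])
  have "R powr \<alpha> \<le> (2 * Rinf / R0) powr \<alpha> * t powr \<alpha>"
    using Rle R(1) R0 t0 \<alpha> powr_mono2[of \<alpha> R "2 * Rinf / R0 * t"] by (simp only: powr_mult)
  then have "((M * Rinf / R0) powr \<alpha> * R powr \<alpha>) * (3 * D)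
      \<le> ((M * Rinf / R0) powr \<alpha> * ((2 * Rinf / R0) powr \<alpha> * t powr \<alpha>)) * (3 * D)"
    using D by (intro mult_right_mono mult_left_mono) auto
  with le have "cvalue p R e x \<le> 3 * D * (M * Rinf / R0) powr \<alpha> * (2 * Rinf / R0) powr \<alpha> * bdist \<Omega> x powr \<alpha>"
    by (simp add: t_def mult_ac)
  then show ?thesis using that c by blast
qed

lemma phi_bounds:
  assumes "x \<in> \<Omega>"
  shows "D / (4 * M) * bdist \<Omega> x powr \<alpha> \<le> phi x"
    "phi x \<le> 3 * D * (M * Rinf / R0) powr \<alpha> * (2 * Rinf / R0) powr \<alpha> * bdist \<Omega> x powr \<alpha>"
proof -
  obtain p R e where c: "candidate p R e x"
    "cvalue p R e x \<le> 3 * D * (M * Rinf / R0) powr \<alpha> * (2 * Rinf / R0) powr \<alpha> * bdist \<Omega> x powr \<alpha>"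
    using candidate_ex[OF assms] .
  show "phi x \<le> 3 * D * (M * Rinf / R0) powr \<alpha> * (2 * Rinf / R0) powr \<alpha> * bdist \<Omega> x powr \<alpha>"
    using phi_le[OF c(1)] c(2) by simp
  have "D / (4 * M) * bdist \<Omega> x powr \<alpha> \<le> Inf {cvalue p R e x |p R e. candidate p R e x}"
    using c(1) candidate_value_lower by (intro cInf_greatest) auto
  then show "D / (4 * M) * bdist \<Omega> x powr \<alpha> \<le> phi x" using assms by (simp add: phi_def)
qed

text \<open>Only a barrier valid around \<open>x\<close> can be compared at \<open>x\<close> and at
  its neighbours. If \<open>x\<close> lies in the outer half of the ball, a scale at least
  \<open>M\<close> times larger makes the barrier small enough to outweigh the growth of the
  weight.\<close>

lemma candidate_improve:
  assumes c: "candidate p R e x"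
  obtains R' e' where "candidate p R' e' x" "2 * norm (x - p) < R'" "cvalue p R' e' x \<le> cvalue p R e x"
proof (cases "2 * norm (x - p) < R")
  case True
  then show ?thesis using that[of R e] c by simp
next
  case False
  note cs = candidate_scale[OF c]
  \<comment> \<open>Multiply by \<open>M\<close>, unless that leads out of the small scales; then go
    to \<open>M * Rinf\<close>. The condition \<open>R0 < R\<close> makes
    \<open>R = R0 = Rinf\<close> count as a small scale, as in \<open>weight\<close>.\<close>
  define R' where "R' = (if M * R \<le> R0 \<or> Rinf \<le> R \<and> R0 < R then M * R else M * Rinf)"
  have MR: "2 * R \<le> M * R" using M cs(1) by simp
  have MRinf: "2 * Rinf \<le> M * Rinf" using M R0 by simp
  have R_cases: "R \<le> R0 \<or> Rinf \<le> R \<and> R0 < R" using c R0 by (auto simp: candidate_def)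
  have MR': "M * R \<le> R'"
  proof (cases "M * R \<le> R0 \<or> Rinf \<le> R \<and> R0 < R")
    case True
    then show ?thesis by (simp add: R'_def)
  next
    case False
    then have "R \<le> Rinf" using R_cases R0 by auto
    then show ?thesis using False M by (auto simp: R'_def)
  qed
  have R': "0 < R'" "R' \<le> R0 \<or> Rinf \<le> R'"
  proof -
    show "0 < R'" using MR' MR cs(1) by linarith
    have "Rinf \<le> M * R" if "Rinf \<le> R" using that MR cs(1) by linarith
    then show "R' \<le> R0 \<or> Rinf \<le> R'" using MRinf R0 by (auto simp: R'_def)
  qed
  have ratio: "norm (x - p) / R' \<le> 1 / M"
  proof -
    have "M * norm (x - p) \<le> M * R" using cs(3) M by (intro mult_left_mono) auto
    then have "M * norm (x - p) \<le> R'" using MR' by linarith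
    then show ?thesis using R'(1) M by (simp add: field_simps)
  qed
  have far: "norm (x - p) < R'" "2 * norm (x - p) < R'" using cs(1,3) MR MR' by linarith+
  obtain e' where e': "admissible \<Omega> (1 / (2 * M)) p R' e' x"
    using admissible_ex[OF cs(6) R', of x] cs(2) far(1) by (auto simp: dist_norm norm_minus_commute)
  then have c': "candidate p R' e' x" using cs(6) R' by (simp add: candidate_def)
  \<comment> \<open>Within one branch of \<open>weight\<close> the growth is exactly
    \<open>M powr \<alpha>\<close>. Across the gap, the small-scale factor turns
    \<open>(M * Rinf) powr \<alpha>\<close> into a multiple of \<open>R0 powr \<alpha>\<close>, and
    \<open>R0 < M * R\<close>.\<close>
  have weight_step: "weight R' \<le> M powr \<alpha> * weight R"
  proof (cases "M * R \<le> R0 \<or> Rinf \<le> R \<and> R0 < R")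
    case True
    then have "R' = M * R" by (simp add: R'_def)
    moreover have "M * R \<le> R0 \<longleftrightarrow> R \<le> R0" using True MR cs(1) R0 by linarith
    ultimately have "R' = M * R" "R' \<le> R0 \<longleftrightarrow> R \<le> R0" by auto
    then show ?thesis using M cs(1) by (simp add: weight_def powr_mult mult_ac)
  next
    case False
    then have R: "R' = M * Rinf" "R \<le> R0" "R0 < M * R" using R_cases by (auto simp: R'_def)
    have "R' > R0" using R(1) MRinf R0 by linarith
    then have "weight R' = (M * Rinf) powr \<alpha>" using R(1) by (simp add: weight_def)
    also have "\<dots> = (M * Rinf / R0) powr \<alpha> * R0 powr \<alpha>"
      using R0 M by (simp add: powr_mult[symmetric])
    also have "\<dots> \<le> (M * Rinf / R0) powr \<alpha> * (M * R) powr \<alpha>"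
      using R(3) R0 \<alpha> by (intro mult_left_mono powr_mono2) auto
    also have "\<dots> = M powr \<alpha> * weight R"
      using R(2) M cs(1) by (simp add: weight_def powr_mult)
    finally show ?thesis .
  qed
  have "barrier D (1 / (2 * M)) p R' e' x \<le> D * (2 * (1 / (2 * M)) + 1 / M) + (1 / M)\<^sup>2"
    using candidate_scale[OF c'] ratio D by (intro barrier_upper) auto
  also have "(1 / M)\<^sup>2 \<le> D * (1 / M)"
  proof -
    have "1 / M \<le> 1" using M by simp
    then have "1 / M \<le> D" using D by linarith
    then show ?thesis using M unfolding power2_eq_square by (intro mult_right_mono) auto
  qed
  finally have b': "barrier D (1 / (2 * M)) p R' e' x \<le> 3 * D / M" by (simp add: algebra_simps)
  \<comment> \<open>Here \<open>norm (x - p) \<ge> R / 2\<close>, so the squared norm alone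
    contributes 1/4.\<close>
  have "(1/2)\<^sup>2 \<le> (norm (x - p) / R)\<^sup>2"
    using False cs(1) by (intro power_mono) (auto simp: field_simps)
  moreover have "0 \<le> D / (4 * M)" using D M by simp
  moreover have "(1/2)\<^sup>2 = (1/4 :: real)" by (simp add: power2_eq_square)
  ultimately have b: "1 / 4 \<le> barrier D (1 / (2 * M)) p R e x"
    using candidate_barrier_lower[OF c] by linarith
  have "cvalue p R' e' x \<le> (M powr \<alpha> * weight R) * (3 * D / M)"
    unfolding cvalue_def using b' D M
    by (intro order_trans[OF mult_left_mono[OF b'] mult_right_mono[OF weight_step]])
       (auto intro: less_imp_le weight_bounds(3) R'(1))
  \<comment> \<open>The 12 in \<open>decay\<close> is 3 from the upper bound
    \<open>3 * D / M\<close> at the new scale times 4 from the lower bound 1/4 at the old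
    one.\<close>
  also have "\<dots> = weight R * (12 * D * M powr \<alpha> / M * (1 / 4))" by simp
  also have "\<dots> \<le> weight R * (1 * (1 / 4))"
    using decay M weight_bounds(3)[OF cs(1)] by (intro mult_left_mono mult_right_mono) (auto simp: field_simps)
  also have "\<dots> \<le> cvalue p R e x"
    unfolding cvalue_def using b weight_bounds(3)[OF cs(1)] by (intro mult_left_mono) auto
  finally show ?thesis using that c' far(2) by blast
qed

text \<open>The infimum may fail to be attained, so no barrier touching \<open>phi\<close> at
  \<open>x\<close> is selected. Instead the average \<open>S / (2 * n)\<close> is placed below every
  candidate value at \<open>x\<close>, and the infimum is taken afterwards.\<close>

lemma phi_second_difference:
  fixes v :: "'k::finite \<Rightarrow> real^'n"
  assumes x: "x \<in> \<Omega>" and v: "\<And>k. norm (v k) < bdist \<Omega> x"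
    and ell: "\<And>e. norm e = 1 \<Longrightarrow> (\<Sum>k\<in>UNIV. (norm (v k))\<^sup>2) \<le> D * (\<Sum>k\<in>UNIV. (v k \<bullet> e)\<^sup>2)"
  shows "(\<Sum>k\<in>UNIV. phi (x + v k) + phi (x - v k) - 2 * phi x) \<le> 0"
proof -
  define S where "S = (\<Sum>k\<in>UNIV. phi (x + v k) + phi (x - v k))"
  define n where "n = real (CARD('k))"
  have n: "n > 0" by (simp add: n_def)
  have "S / (2 * n) \<le> cvalue p R e x" if c: "candidate p R e x" for p R e
  proof -
    obtain R' e' where c': "candidate p R' e' x" "2 * norm (x - p) < R'" "cvalue p R' e' x \<le> cvalue p R e x"
      using candidate_improve[OF c] .
    note cs = candidate_scale[OF c'(1)]
    \<comment> \<open>The improved candidate remains one at \<open>x + v k\<close> and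
      \<open>x - v k\<close>, so its values bound \<open>phi\<close> there.\<close>
    have near: "candidate p R' e' (x + w)" if "norm w < bdist \<Omega> x" for w
      using c'(1) admissible_near[of \<Omega> _ p R' e' x w] c'(2) that by (simp add: candidate_def)
    let ?b = "barrier D (1 / (2 * M)) p R' e'"
    have "S \<le> (\<Sum>k\<in>UNIV. weight R' * (?b (x + v k) + ?b (x - v k)))"
      unfolding S_def
    proof (intro sum_mono)
      fix k
      have "phi (x + v k) \<le> weight R' * ?b (x + v k)" "phi (x - v k) \<le> weight R' * ?b (x - v k)"
        using phi_le[OF near[of "v k"]] phi_le[OF near[of "- v k"]] v by (auto simp: cvalue_def)
      then show "phi (x + v k) + phi (x - v k) \<le> weight R' * (?b (x + v k) + ?b (x - v k))"
        by (simp add: distrib_left)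
    qed
    also have "\<dots> = weight R' * (\<Sum>k\<in>UNIV. 2 * ?b x + 2 * ((norm (v k))\<^sup>2 - D * (v k \<bullet> e')\<^sup>2) / R'\<^sup>2)"
      unfolding sum_distrib_left[symmetric]
      using barrier_second_difference[of D "1 / (2 * M)" p R' e' x "v _"]
      by (intro arg_cong2[where f="(*)"] sum.cong refl) (simp add: algebra_simps)
    also have "(\<Sum>k\<in>UNIV. 2 * ?b x + 2 * ((norm (v k))\<^sup>2 - D * (v k \<bullet> e')\<^sup>2) / R'\<^sup>2)
       = 2 * n * ?b x + 2 * ((\<Sum>k\<in>UNIV. (norm (v k))\<^sup>2) - D * (\<Sum>k\<in>UNIV. (v k \<bullet> e')\<^sup>2)) / R'\<^sup>2"
      by (simp add: sum.distrib n_def sum_divide_distrib[symmetric] sum_distrib_left[symmetric] sum_subtractf)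
    also have "\<dots> \<le> 2 * n * ?b x"
      using ell[OF cs(5)] by (simp add: divide_nonpos_nonneg)
    finally have "S \<le> weight R' * (2 * n * ?b x)"
      using weight_bounds(3)[OF cs(1)] by simp
    then have "S / (2 * n) \<le> cvalue p R' e' x" using n by (simp add: cvalue_def field_simps)
    then show ?thesis using c'(3) by simp
  qed
  moreover obtain p R e where "candidate p R e x" using candidate_ex[OF x] .
  ultimately have "S / (2 * n) \<le> phi x"
    using x unfolding phi_def by (auto intro!: cInf_greatest)
  then show ?thesis using n by (simp add: sum_subtractf S_def n_def field_simps)
qed

text \<open>An infimum of continuous functions on open sets is upper semicontinuous: its strict
  sublevel sets in \<open>\<Omega>\<close> are unions of open sets, however many barriers there
  are.\<close>

lemma borel_measurable_phi: "phi \<in> borel_measurable borel"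
  unfolding borel_measurable_iff_less
proof
  fix c
  have "phi x < c \<longleftrightarrow> (\<exists>p R e. candidate p R e x \<and> cvalue p R e x < c)" if x: "x \<in> \<Omega>" for x
  proof -
    obtain p R e where "candidate p R e x" using candidate_ex[OF x] .
    then show ?thesis
      using x cInf_less_iff[OF _ bdd_below_values[of x], of c] by (auto simp: phi_def)
  qed
  then have "{x \<in> \<Omega>. phi x < c} = (\<Union>p. \<Union>R. \<Union>e. {x. candidate p R e x} \<inter> {x. cvalue p R e x < c})"
    by (auto dest: candidate_scale(2))
  moreover have "open (\<Union>p. \<Union>R. \<Union>e. {x. candidate p R e x} \<inter> {x. cvalue p R e x < c})"
  proof (intro open_UN open_Int ballI)
    show "open {x. candidate p R e x}" for p R e
      using open_admissible[OF open_dom, of "1 / (2 * M)" p R e]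
      unfolding candidate_def by (intro open_Collect_conj open_Collect_const)
    show "open {x. cvalue p R e x < c}" for p R e
      unfolding cvalue_def barrier_def divide_inverse
      by (intro open_Collect_less continuous_intros)
  qed
  ultimately have "{x \<in> \<Omega>. phi x < c} \<in> sets borel" by simp
  \<comment> \<open>Off \<open>\<Omega>\<close> the value 0 adds the whole complement exactly when
    \<open>0 < c\<close>.\<close>
  moreover have "{x. phi x < c} = {x \<in> \<Omega>. phi x < c} \<union> (if 0 < c then - \<Omega> else {})"
    by (auto simp: phi_def split: if_splits)
  moreover have "(if 0 < c then - \<Omega> else {}) \<in> sets borel" using open_dom by auto
  ultimately show "{w \<in> space borel. phi w < c} \<in> sets borel" by (simp del: if_split)
qed

lemma phi_bounded_on_compact:
  assumes "compact K" "K \<subseteq> \<Omega>"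
  shows "\<exists>B. \<forall>x\<in>K. \<bar>phi x\<bar> \<le> B"
proof -
  define N where "N = 3 * D * (M * Rinf / R0) powr \<alpha> * (2 * Rinf / R0) powr \<alpha>"
  have N: "0 \<le> N" using D by (simp add: N_def)
  have "compact (bdist \<Omega> ` K)"
    unfolding bdist_def by (intro compact_continuous_image continuous_intros assms)
  then obtain b where b: "\<And>x. x \<in> K \<Longrightarrow> norm (bdist \<Omega> x) \<le> b"
    by (meson bounded_iff compact_imp_bounded image_eqI)
  have "\<bar>phi x\<bar> \<le> N * b powr \<alpha>" if "x \<in> K" for x
  proof -
    have "0 \<le> D / (4 * M) * bdist \<Omega> x powr \<alpha>" using D M by simp
    then have "\<bar>phi x\<bar> = phi x" using phi_bounds(1)[of x] assms that by auto
    also have "\<dots> \<le> N * bdist \<Omega> x powr \<alpha>" using phi_bounds(2)[of x] assms that by (auto simp: N_def)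
    also have "\<dots> \<le> N * b powr \<alpha>"
      using b[OF that] N \<alpha> by (intro mult_left_mono powr_mono2) (auto simp: bdist_def infdist_nonneg)
    finally show ?thesis .
  qed
  then show ?thesis by blast
qed

end

section \<open>Constant-coefficient operators\<close>

lemma inner_matrix_vector_sum:
  fixes a :: "real^'n::finite^'n"
  shows "\<xi> \<bullet> (a *v \<xi>) = (\<Sum>i\<in>UNIV. \<Sum>j\<in>UNIV. \<xi> $ i * \<xi> $ j * a $ i $ j)"
  by (simp add: inner_vec_def matrix_vector_mult_def sum_distrib_left mult_ac)

text \<open>The quadratic form at \<open>e\<close> is the sum of the squares
  \<open>(u k \<bullet> e)\<^sup>2\<close>, which gives the lower bound; the squared lengths sum to
  the trace, whose diagonal entries are at most \<open>\<nu>2\<close>.\<close>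

lemma Mat_rank_one_sum:
  fixes a :: "real^'n::finite^'n" and \<nu>1 \<nu>2 :: real
  assumes a: "a \<in> Mat \<nu>1 \<nu>2" and \<nu>: "0 \<le> \<nu>1"
  obtains u :: "'n \<Rightarrow> real^'n" where "\<And>i j. a $ i $ j = (\<Sum>k\<in>UNIV. u k $ i * u k $ j)"
    "\<And>e. norm e = 1 \<Longrightarrow> \<nu>1 \<le> (\<Sum>k\<in>UNIV. (u k \<bullet> e)\<^sup>2)"
    "(\<Sum>k\<in>UNIV. (norm (u k))\<^sup>2) \<le> CARD('n) * \<nu>2"
proof -
  have sym: "a $ i $ j = a $ j $ i" for i j
    using a unfolding Mat_def transpose_def by (auto simp: vec_eq_iff)
  have ell: "\<nu>1 * (norm \<xi>)\<^sup>2 \<le> \<xi> \<bullet> (a *v \<xi>)" "\<xi> \<bullet> (a *v \<xi>) \<le> \<nu>2 * (norm \<xi>)\<^sup>2" for \<xi>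
    using a by (auto simp: Mat_def)
  have "0 \<le> (\<Sum>i\<in>UNIV. \<Sum>j\<in>UNIV. \<xi> i * \<xi> j * a $ i $ j)" for \<xi>
  proof -
    have "0 \<le> \<nu>1 * (norm (\<chi> i. \<xi> i))\<^sup>2" using \<nu> by simp
    also have "\<dots> \<le> (\<Sum>i\<in>UNIV. \<Sum>j\<in>UNIV. \<xi> i * \<xi> j * a $ i $ j)"
      using ell(1)[of "\<chi> i. \<xi> i"] unfolding inner_matrix_vector_sum by simp
    finally show ?thesis .
  qed
  then obtain w :: "'n \<Rightarrow> 'n \<Rightarrow> real" where w: "\<And>i j. a $ i $ j = (\<Sum>k\<in>UNIV. w k i * w k j)"
    using psd_rank_one_sum[of UNIV "\<lambda>i j. a $ i $ j"] sym by auto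
  define u :: "'n \<Rightarrow> real^'n" where "u k = (\<chi> i. w k i)" for k
  have u: "a $ i $ j = (\<Sum>k\<in>UNIV. u k $ i * u k $ j)" for i j by (simp add: w u_def)
  have quad: "e \<bullet> (a *v e) = (\<Sum>k\<in>UNIV. (u k \<bullet> e)\<^sup>2)" for e
  proof -
    have "e \<bullet> (a *v e) = (\<Sum>i\<in>UNIV. \<Sum>j\<in>UNIV. \<Sum>k\<in>UNIV. (u k $ i * e $ i) * (u k $ j * e $ j))"
      unfolding inner_matrix_vector_sum u by (simp add: sum_distrib_left mult_ac)
    also have "\<dots> = (\<Sum>i\<in>UNIV. \<Sum>k\<in>UNIV. \<Sum>j\<in>UNIV. (u k $ i * e $ i) * (u k $ j * e $ j))"
      by (intro sum.cong refl sum.swap)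
    also have "\<dots> = (\<Sum>k\<in>UNIV. \<Sum>i\<in>UNIV. \<Sum>j\<in>UNIV. (u k $ i * e $ i) * (u k $ j * e $ j))"
      by (rule sum.swap)
    also have "\<dots> = (\<Sum>k\<in>UNIV. (u k \<bullet> e)\<^sup>2)"
      by (simp add: inner_vec_def power2_eq_square sum_product)
    finally show ?thesis .
  qed
  have "(\<Sum>k\<in>UNIV. (norm (u k))\<^sup>2) = (\<Sum>k\<in>UNIV. \<Sum>i\<in>UNIV. u k $ i * u k $ i)"
    by (simp add: power2_norm_eq_inner inner_vec_def)
  also have "\<dots> = (\<Sum>i\<in>UNIV. \<Sum>k\<in>UNIV. u k $ i * u k $ i)"
    by (rule sum.swap)
  also have "\<dots> = (\<Sum>i\<in>UNIV. axis i 1 \<bullet> (a *v axis i 1))"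
    unfolding quad by (simp add: inner_axis power2_eq_square)
  also have "\<dots> \<le> (\<Sum>i\<in>(UNIV::'n set). \<nu>2)"
    using ell(2)[of "axis _ 1"] by (intro sum_mono) simp
  finally have "(\<Sum>k\<in>UNIV. (norm (u k))\<^sup>2) \<le> CARD('n) * \<nu>2" by simp
  moreover have "\<nu>1 \<le> (\<Sum>k\<in>UNIV. (u k \<bullet> e)\<^sup>2)" if "norm e = 1" for e
    using ell(1)[of e] that unfolding quad by simp
  ultimately show ?thesis using that u by blast
qed

text \<open>The hypothesis \<open>le\<close> balances trace against ellipticity: the squared lengths
  of the \<open>u k\<close> sum to at most \<open>D * \<nu>1\<close>, hence to at most
  \<open>D\<close> times the form at any unit direction a barrier may have.\<close>

lemma (in barrier_scales) distrib_supersol_phi: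
  fixes \<nu>1 \<nu>2 :: real
  assumes a: "a \<in> Mat \<nu>1 \<nu>2" and \<nu>: "0 \<le> \<nu>1" and le: "CARD('n) * \<nu>2 \<le> D * \<nu>1"
  shows "distrib_supersol a \<Omega> phi"
proof -
  obtain u :: "'n \<Rightarrow> real^'n" where u: "\<And>i j. a $ i $ j = (\<Sum>k\<in>UNIV. u k $ i * u k $ j)"
    "\<And>e. norm e = 1 \<Longrightarrow> \<nu>1 \<le> (\<Sum>k\<in>UNIV. (u k \<bullet> e)\<^sup>2)"
    "(\<Sum>k\<in>UNIV. (norm (u k))\<^sup>2) \<le> CARD('n) * \<nu>2"
    by (rule Mat_rank_one_sum[OF a \<nu>]) (rule that)
  show ?thesis
  proof (rule distrib_supersol_second_differences[where u=u, OF open_dom borel_measurable_phi _ u(1)])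
    show "\<exists>B. \<forall>x\<in>K. \<bar>phi x\<bar> \<le> B" if "compact K" "K \<subseteq> \<Omega>" for K
      using phi_bounded_on_compact that .
    fix K assume K: "compact K" "K \<subseteq> \<Omega>"
    obtain K' e where K': "K' \<subseteq> \<Omega>" "0 < e" "\<And>x v. x \<in> K \<Longrightarrow> norm v \<le> e \<Longrightarrow> x + v \<in> K'"
      by (rule compact_thickening_in_open[OF K(1) open_dom K(2)]) (rule that)
    \<comment> \<open>The frontier of an open set is disjoint from it, so the thickening keeps it at
      distance at least \<open>e\<close>; steps shorter than \<open>e\<close> then satisfy
      \<open>phi_second_difference\<close>.\<close>
    have far: "e \<le> bdist \<Omega> x" if x: "x \<in> K" for x
      unfolding bdist_def infdist_notempty[OF frontier_ne]
    proof (intro cINF_greatest frontier_ne)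
      fix y assume y: "y \<in> frontier \<Omega>"
      have "y \<notin> \<Omega>" using y open_dom by (simp add: frontier_def interior_open)
      then have "\<not> norm (y - x) \<le> e" using K'(3)[OF x, of "y - x"] K'(1) by auto
      then show "e \<le> dist x y" by (simp add: dist_norm norm_minus_commute)
    qed
    define L where "L = 1 + (\<Sum>k\<in>UNIV. norm (u k))"
    have L: "norm (u k) < L" for k
      using member_le_sum[of k UNIV "\<lambda>k. norm (u k)"] by (simp add: L_def)
    have L0: "0 < L" using le_less_trans[OF norm_ge_zero L] .
    have "(\<Sum>k\<in>UNIV. phi (x + h *\<^sub>R u k) + phi (x - h *\<^sub>R u k) - 2 * phi x) \<le> 0"
      if x: "x \<in> K" and h: "0 < h" "h < e / L" for x h
    proof (rule phi_second_difference)
      show "x \<in> \<Omega>" using x K by auto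
      show "norm (h *\<^sub>R u k) < bdist \<Omega> x" for k
      proof -
        have "h * norm (u k) \<le> h * L" using h L[of k] by simp
        also have "\<dots> < e" using h L0 by (simp add: field_simps)
        finally show ?thesis using far[OF x] h by simp
      qed
      fix v :: "real^'n" assume v: "norm v = 1"
      have "(\<Sum>k\<in>UNIV. (norm (u k))\<^sup>2) \<le> D * (\<Sum>k\<in>UNIV. (u k \<bullet> v)\<^sup>2)"
        using u(3) le mult_left_mono[OF u(2)[OF v], of D] D by linarith
      then have "h\<^sup>2 * (\<Sum>k\<in>UNIV. (norm (u k))\<^sup>2) \<le> h\<^sup>2 * (D * (\<Sum>k\<in>UNIV. (u k \<bullet> v)\<^sup>2))"
        by (intro mult_left_mono) auto
      then show "(\<Sum>k\<in>UNIV. (norm (h *\<^sub>R u k))\<^sup>2) \<le> D * (\<Sum>k\<in>UNIV. (h *\<^sub>R u k \<bullet> v)\<^sup>2)"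
        by (simp add: power_mult_distrib sum_distrib_left mult_ac)
    qed
    then show "\<exists>h0>0. \<forall>x\<in>K. \<forall>h. 0 < h \<and> h < h0 \<longrightarrow>
       (\<Sum>k\<in>UNIV. phi (x + h *\<^sub>R u k) + phi (x - h *\<^sub>R u k) - 2 * phi x) \<le> 0"
      using K'(2) L0 by (intro exI[of _ "e / L"]) auto
  qed
qed

section \<open>Choice of the constants and the two-sided estimate\<close>

theorem theorem5p19:
  assumes "CARD('n::finite) \<ge> 2"
    and "0 < \<nu>" and "\<nu> \<le> (1::real)" and "0 < \<epsilon>" and "\<epsilon> < (1::real)"
  shows "\<exists>\<delta>1>0. \<forall>r. 0 < r \<and> r \<le> 1 \<longrightarrow> (\<exists>N>0.
     \<forall>(\<Omega>::(real^'n) set) R0 Rinf. domain \<Omega> \<and> TER_radii \<Omega> \<delta>1 R0 Rinf \<and> R0 / Rinf = r \<longrightarrow>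
       (\<exists>\<phi>. \<phi> \<in> borel_measurable (lebesgue_on \<Omega>) \<and>
          (\<forall>a\<in>Mat (\<nu>^2) 1. distrib_supersol a \<Omega> \<phi>) \<and>
          (\<forall>x\<in>\<Omega>. bdist \<Omega> x powr (1 - \<epsilon>) / N \<le> \<phi> x \<and>
                   \<phi> x \<le> N * bdist \<Omega> x powr (1 - \<epsilon>))))"
proof -
  \<comment> \<open>Bounds the trace divided by the least eigenvalue for every matrix in
    \<open>Mat (\<nu>^2) 1\<close>.\<close>
  define D where "D = CARD('n) / \<nu>\<^sup>2"
  have "\<nu>\<^sup>2 \<le> 1" "0 < \<nu>\<^sup>2" using assms(2,3) by (auto simp: power_le_one)
  then have D1: "1 \<le> D" using assms(1) by (simp add: D_def)
  have D\<nu>: "real CARD('n) * 1 \<le> D * \<nu>\<^sup>2" using assms(2) by (simp add: D_def)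
  \<comment> \<open>Solves \<open>M powr \<epsilon> = 12 * D\<close>, which makes
    \<open>decay\<close> an equality.\<close>
  define M where "M = (12 * D) powr (1 / \<epsilon>)"
  have "(12 * D) powr 1 \<le> M"
    unfolding M_def using D1 assms(4,5) by (intro powr_mono) auto
  then have M: "12 \<le> M" using D1 by simp
  have "M powr \<epsilon> = 12 * D" using D1 assms(4) by (simp add: M_def powr_powr)
  then have "12 * D * M powr (1 - \<epsilon>) = M powr \<epsilon> * M powr (1 - \<epsilon>)" by simp
  also have "\<dots> = M" using M by (simp add: powr_add[symmetric])
  finally have decay: "12 * D * M powr (1 - \<epsilon>) \<le> M" by simp
  \<comment> \<open>Half of the barriers' aperture \<open>1 / (2 * M)\<close>, because
    \<open>delta_Omega_admissible\<close> doubles it.\<close>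
  define \<delta>1 where "\<delta>1 = 1 / (4 * M)"
  have \<delta>1: "0 < \<delta>1" "2 * \<delta>1 = 1 / (2 * M)" using M by (auto simp: \<delta>1_def)
  have "\<exists>N>0. \<forall>(\<Omega>::(real^'n) set) R0 Rinf. domain \<Omega> \<and> TER_radii \<Omega> \<delta>1 R0 Rinf \<and> R0 / Rinf = r \<longrightarrow>
       (\<exists>\<phi>. \<phi> \<in> borel_measurable (lebesgue_on \<Omega>) \<and>
          (\<forall>a\<in>Mat (\<nu>^2) 1. distrib_supersol a \<Omega> \<phi>) \<and>
          (\<forall>x\<in>\<Omega>. bdist \<Omega> x powr (1 - \<epsilon>) / N \<le> \<phi> x \<and>
                   \<phi> x \<le> N * bdist \<Omega> x powr (1 - \<epsilon>)))"
    if r: "0 < r" "r \<le> 1" for r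
  proof -
    \<comment> \<open>The upper constant of \<open>phi_bounds\<close> with \<open>Rinf / R0\<close>
      replaced by \<open>1 / r\<close>, so that the domain enters \<open>N\<close> only through
      \<open>r\<close>.\<close>
    define U where "U = 3 * D * (M / r) powr (1 - \<epsilon>) * (2 / r) powr (1 - \<epsilon>)"
    have U: "0 < U" using D1 M r unfolding U_def by (intro mult_pos_pos) auto
    define N where "N = U + 4 * M / D"
    have MD: "0 < 4 * M / D" using M D1 by (intro divide_pos_pos) auto
    have N: "0 < N" "U \<le> N" "4 * M / D \<le> N" using U MD by (auto simp: N_def)
    have N_inv: "1 / N \<le> D / (4 * M)"
    proof -
      have "1 / N \<le> 1 / (4 * M / D)" using N(3) MD by (intro frac_le) auto
      then show ?thesis by simp
    qed
    have "\<exists>\<phi>. \<phi> \<in> borel_measurable (lebesgue_on \<Omega>) \<and>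
          (\<forall>a\<in>Mat (\<nu>^2) 1. distrib_supersol a \<Omega> \<phi>) \<and>
          (\<forall>x\<in>\<Omega>. bdist \<Omega> x powr (1 - \<epsilon>) / N \<le> \<phi> x \<and>
                   \<phi> x \<le> N * bdist \<Omega> x powr (1 - \<epsilon>))"
      if dom: "domain \<Omega>" and TER: "TER_radii \<Omega> \<delta>1 R0 Rinf" and ratio: "R0 / Rinf = r"
      for \<Omega> :: "(real^'n) set" and R0 Rinf
    proof (cases "frontier \<Omega> = {}")
      \<comment> \<open>Without a frontier \<open>infdist\<close> is 0 by convention, so both bounds
        reduce to 0 and the zero function satisfies everything.\<close>
      case True
      then show ?thesis
        by (intro exI[of _ "\<lambda>_. 0"])
           (auto simp: bdist_def infdist_def distrib_supersol_def set_integrable_def set_lebesgue_integral_def)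
    next
      case False
      interpret barrier_scales \<Omega> R0 Rinf "1 - \<epsilon>" D M
      proof
        show "open \<Omega>" using dom by (simp add: domain_def)
        show "\<exists>e. admissible \<Omega> (1 / (2 * M)) p R e x"
          if "p \<in> frontier \<Omega>" "0 < R" "R \<le> R0 \<or> Rinf \<le> R" "x \<in> \<Omega> \<inter> ball p R" for p R x
        proof -
          have "delta_Omega \<Omega> R \<le> \<delta>1" using TER that(2,3) by (auto simp: TER_radii_def)
          then show ?thesis
            using delta_Omega_admissible[OF _ \<delta>1(1) that(2,1,4)] unfolding \<delta>1(2) by blast
        qed
      qed (use TER False D1 M decay assms in \<open>auto simp: TER_radii_def\<close>)
      have ratios: "M * Rinf / R0 = M / r" "2 * Rinf / R0 = 2 / r"
        using ratio R0 by (auto simp: field_simps)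
      have "phi \<in> borel_measurable (lebesgue_on \<Omega>)"
        using borel_measurable_phi by (intro measurable_restrict_space1 measurable_completion) simp
      moreover have "distrib_supersol a \<Omega> phi" if "a \<in> Mat (\<nu>\<^sup>2) 1" for a
        using distrib_supersol_phi[OF that _ D\<nu>] by simp
      moreover have "bdist \<Omega> x powr (1 - \<epsilon>) / N \<le> phi x" "phi x \<le> N * bdist \<Omega> x powr (1 - \<epsilon>)"
        if x: "x \<in> \<Omega>" for x
      proof -
        show "bdist \<Omega> x powr (1 - \<epsilon>) / N \<le> phi x"
          using phi_bounds(1)[OF x] mult_right_mono[OF N_inv, of "bdist \<Omega> x powr (1 - \<epsilon>)"] by simp
        show "phi x \<le> N * bdist \<Omega> x powr (1 - \<epsilon>)"
          using phi_bounds(2)[OF x] mult_right_mono[OF N(2), of "bdist \<Omega> x powr (1 - \<epsilon>)"]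
          unfolding ratios U_def by simp
      qed
      ultimately show ?thesis by blast
    qed
    then show ?thesis using N(1) by blast
  qed
  then show ?thesis using \<delta>1(1) by blast
qed

end
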